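(* Assume that $(A,b)$ is controllable and let $C\in\mathbb R^{1\times n}$, $C\neq 0$. Let $r$ be the relative degree of the output $y=Cx$. Then, for every target $f\in H^r_0(0,T)$, there exists a control $u\in L^2(0,T)$ such that the corresponding solution of $x'(t)=Ax(t)+bu(t)$, $x(0)=0$, satisfies $$Cx(t)=f(t),\qquad t\in[0,T].$$ Moreover, in controller coordinates the control can be obtained by differentiating the relation $\widetilde C z=f$ exactly $r$ times.
   Context: $T>0$ is fixed, $A\in\mathbb R^{n\times n}$, $b\in\mathbb R^n$, and the control $u:[0,T]\to\mathbb R$ is scalar. The pair $(A,b)$ is controllable if $\operatorname{rank}[b,Ab,\ldots,A^{n-1}b]=n$. Controller coordinates: since $(A,b)$ is controllable, there is an invertible $P\in\mathbb R^{n\times n}$ such that, with $x=Pz$, the system becomes $z'(t)=\widetilde Az(t)+\widetilde bu(t)$, where $\widetilde A=P^{-1}AP$ is the companion matrix with ones on the superdiagonal, last row $(-a_0,-a_1,\ldots,-a_{n-1})$ and zeros elsewhere, and $\widetilde b=P^{-1}b=(0,\ldots,0,1)^{\mathsf T}$. The output becomes $y=Cx=\widetilde Cz$, with $\widetilde C=CP=(\eta_1,\ldots,\eta_n)$. Relative degree: $r:=n-k_*+1$, where $k_*:=\max\{j\in\{1,\ldots,n\}:\eta_j\neq0\}$; equivalently, $r$ is the smallest positive integer such that $CA^{r-1}b\neq0$. $H^r_0(0,T):=\{\phi\in H^r(0,T):\phi^{(k)}(0)=0,\ k=0,\ldots,r-1\}$ (no condition is imposed at $t=T$). *)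

theory Defs
  imports "HOL-Analysis.Analysis" "Jordan_Normal_Form.DL_Rank"
begin

unbundle no vec_syntax

section \<open>Square integrable functions and Sobolev spaces on an interval\<close>

text \<open>Elements of \<open>L\<^sup>2(0,T)\<close> are represented by functions on the whole line whose values outside
  \<open>(0,T)\<close> are irrelevant; no quotient by almost everywhere equality is taken.\<close>

definition L2 :: "real \<Rightarrow> (real \<Rightarrow> real) set" where
  "L2 T = {u. u \<in> borel_measurable (lebesgue_on {0<..<T}) \<and>
              integrable (lebesgue_on {0<..<T}) (\<lambda>t. (u t)\<^sup>2)}"

definition test_function :: "real \<Rightarrow> (real \<Rightarrow> real) \<Rightarrow> bool" where
  "test_function T \<phi> \<longleftrightarrow>
     (\<forall>k t. (deriv ^^ k) \<phi> differentiable (at t)) \<and> closure {t. \<phi> t \<noteq> 0} \<subseteq> {0<..<T}"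

text \<open>\<open>g\<close> is the \<open>k\<close>-th weak derivative of \<open>f\<close> on \<open>(0,T)\<close>. Membership of both functions in \<open>L2\<close> is
  part of the notion, so that the integrals below are never the default value \<open>0\<close> of a
  non-integrable function.\<close>

definition weak_derivative :: "real \<Rightarrow> nat \<Rightarrow> (real \<Rightarrow> real) \<Rightarrow> (real \<Rightarrow> real) \<Rightarrow> bool" where
  "weak_derivative T k f g \<longleftrightarrow> f \<in> L2 T \<and> g \<in> L2 T \<and>
     (\<forall>\<phi>. test_function T \<phi> \<longrightarrow>
        (LINT t|lebesgue_on {0<..<T}. f t * (deriv ^^ k) \<phi> t) =
        (-1) ^ k * (LINT t|lebesgue_on {0<..<T}. g t * \<phi> t))"

definition sobolev :: "nat \<Rightarrow> real \<Rightarrow> (real \<Rightarrow> real) set" where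
  "sobolev r T = {f. \<forall>k\<le>r. \<exists>g. weak_derivative T k f g}"

text \<open>The values \<open>f\<^sup>(\<^sup>k\<^sup>)(0)\<close>, \<open>k < r\<close>, are those of the continuous representatives on \<open>[0,T]\<close> of the
  weak derivatives. Targets are evaluated pointwise on \<open>[0,T]\<close>, so \<open>f\<close> itself is required to be its
  own continuous representative.\<close>

definition sobolev0 :: "nat \<Rightarrow> real \<Rightarrow> (real \<Rightarrow> real) set" where
  "sobolev0 r T = {f \<in> sobolev r T. continuous_on {0..T} f \<and>
     (\<forall>k<r. \<exists>g. weak_derivative T k f g \<and> continuous_on {0..T} g \<and> g 0 = 0)}"


section \<open>Linear control systems with scalar input\<close>

definition controllable :: "nat \<Rightarrow> real mat \<Rightarrow> real vec \<Rightarrow> bool" where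
  "controllable n A b \<longleftrightarrow>
     vec_space.rank n (mat_of_cols n (map (\<lambda>k. (A ^\<^sub>m k) *\<^sub>v b) [0..<n])) = n"

text \<open>Caratheodory solution of \<open>x' = A x + b u\<close>, \<open>x(0) = 0\<close> on \<open>[0,T]\<close>: the function \<open>x\<close> is,
  componentwise, the indefinite Lebesgue integral of the right-hand side.\<close>

definition state :: "nat \<Rightarrow> real mat \<Rightarrow> real vec \<Rightarrow> real \<Rightarrow> (real \<Rightarrow> real) \<Rightarrow> (real \<Rightarrow> real vec) \<Rightarrow> bool" where
  "state n A b T u x \<longleftrightarrow> x 0 = 0\<^sub>v n \<and> (\<forall>t\<in>{0..T}. x t \<in> carrier_vec n) \<and>
     (\<forall>i<n. integrable (lebesgue_on {0..T}) (\<lambda>s. (A *\<^sub>v x s + u s \<cdot>\<^sub>v b) $ i) \<and>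
        (\<forall>t\<in>{0..T}. x t $ i = x 0 $ i + (LINT s|lebesgue_on {0..t}. (A *\<^sub>v x s + u s \<cdot>\<^sub>v b) $ i)))"

text \<open>The scalar \<open>C v\<close> for a \<open>1 \<times> n\<close> matrix \<open>C\<close>.\<close>

definition output_value :: "real mat \<Rightarrow> real vec \<Rightarrow> real" where
  "output_value C v = (C *\<^sub>v v) $ 0"

text \<open>Matrix and vector entries are indexed from \<open>0\<close>, so the last coordinate has index \<open>n - 1\<close>.\<close>

definition companion :: "nat \<Rightarrow> (nat \<Rightarrow> real) \<Rightarrow> real mat" where
  "companion n a = mat n n (\<lambda>(i, j). if i = n - 1 then - a j else if j = i + 1 then 1 else 0)"

definition controller_coordinates ::
    "nat \<Rightarrow> real mat \<Rightarrow> real vec \<Rightarrow> real mat \<Rightarrow> real mat \<Rightarrow> bool" where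
  "controller_coordinates n A b P Pinv \<longleftrightarrow>
     P \<in> carrier_mat n n \<and> Pinv \<in> carrier_mat n n \<and> inverts_mat P Pinv \<and> inverts_mat Pinv P \<and>
     (\<exists>a. Pinv * A * P = companion n a) \<and> Pinv *\<^sub>v b = unit_vec n (n - 1)"

text \<open>To be applied to the output row \<open>(\<eta>\<^sub>1, \<dots>, \<eta>\<^sub>n) = C P\<close> in controller coordinates.\<close>

definition relative_degree :: "nat \<Rightarrow> real mat \<Rightarrow> nat" where
  "relative_degree n \<eta> = n - Max {j \<in> {1..n}. \<eta> $$ (0, j - 1) \<noteq> 0} + 1"

text \<open>Along a solution of \<open>z' = A z + b u\<close>, the \<open>k\<close>-th derivative of \<open>C z\<close> is \<open>C A\<^sup>k z + C A\<^sup>k\<^sup>-\<^sup>1 b u\<close>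
  as long as the lower derivatives do not contain the input. \<open>differentiate_output\<close> says that the
  input appears for the first time in the \<open>r\<close>-th derivative.\<close>

definition differentiate_output ::
    "nat \<Rightarrow> real \<Rightarrow> nat \<Rightarrow> real mat \<Rightarrow> real vec \<Rightarrow> real mat \<Rightarrow> bool" where
  "differentiate_output n T r A b C \<longleftrightarrow>
     (\<forall>k\<in>{1..<r}. output_value (C * A ^\<^sub>m (k - 1)) b = 0) \<and> output_value (C * A ^\<^sub>m (r - 1)) b \<noteq> 0 \<and>
     (\<forall>u\<in>L2 T. \<forall>z. state n A b T u z \<longrightarrow>
        (\<forall>k<r. weak_derivative T k (\<lambda>t. output_value C (z t)) (\<lambda>t. output_value (C * A ^\<^sub>m k) (z t))) \<and>
        weak_derivative T r (\<lambda>t. output_value C (z t))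
          (\<lambda>t. output_value (C * A ^\<^sub>m r) (z t) + output_value (C * A ^\<^sub>m (r - 1)) b * u t))"

text \<open>The \<open>r\<close>-times differentiated relation \<open>f\<^sup>(\<^sup>r\<^sup>) = C A\<^sup>r z + C A\<^sup>r\<^sup>-\<^sup>1 b u\<close>, solved for \<open>u\<close>.\<close>

definition control_law ::
    "real \<Rightarrow> nat \<Rightarrow> real mat \<Rightarrow> real vec \<Rightarrow> real mat \<Rightarrow> (real \<Rightarrow> real) \<Rightarrow> (real \<Rightarrow> real) \<Rightarrow>
     (real \<Rightarrow> real vec) \<Rightarrow> bool" where
  "control_law T r A b C f u z \<longleftrightarrow>
     (\<forall>g. weak_derivative T r f g \<longrightarrow>
        (AE t in lebesgue_on {0<..<T}.
           u t = (g t - output_value (C * A ^\<^sub>m r) (z t)) / output_value (C * A ^\<^sub>m (r - 1)) b))"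

end

theory Submission
  imports Defs
begin

text \<open>Controllability provides a row \<open>q\<close> with \<open>q A\<^sup>k b = 0\<close> for \<open>k < n - 1\<close> and \<open>q A\<^sup>n\<^sup>-\<^sup>1 b = 1\<close>, and the
  rows \<open>q, q A, \<dots>, q A\<^sup>n\<^sup>-\<^sup>1\<close> form the matrix \<open>P\<^sup>-\<^sup>1\<close> of a transformation \<open>x = P z\<close> to
  controller coordinates (\<open>controller_coordinates_exist\<close>). There, multiplying a row
  by a companion matrix shifts it to the right as long as its last entry vanishes; hence \<open>C A\<^sup>k b\<close>, which is the last entry of the \<open>k\<close> times shifted
  row, is nonzero for the first time at \<open>k = r - 1\<close> (\<open>companion_relative_degree\<close>).

  Everything else holds for any system whose numbers \<open>C A\<^sup>k b\<close> behave like this. The output \<open>y = C z\<close> has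
  the derivatives \<open>C A\<^sup>k z\<close> for \<open>k < r\<close> and \<open>C A\<^sup>r z + c u\<close> for \<open>k = r\<close>, where \<open>c = C A\<^sup>r\<^sup>-\<^sup>1 b\<close>; the ones
  of order below \<open>r\<close> are continuous and vanish at \<open>0\<close> because \<open>z(0) = 0\<close>. So \<open>y\<close> belongs to \<open>H\<^sup>r\<^sub>0\<close>. A function in
  \<open>H\<^sup>r\<^sub>0\<close> is determined by its \<open>r\<close>-th weak derivative, and the latter is unique almost everywhere.
  Therefore \<open>y = f\<close> on \<open>[0,T]\<close> is equivalent to \<open>f\<^sup>(\<^sup>r\<^sup>) = C A\<^sup>r z + c u\<close> almost everywhere, that is, to the
  control law (\<open>tracking_iff_control_law\<close>). Inserting the control law into the system gives the linear
  equation \<open>z' = A z + b (f\<^sup>(\<^sup>r\<^sup>) - C A\<^sup>r z) / c\<close>, whose solution yields the control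
  (\<open>closed_loop_state_exists\<close>, \<open>tracking_control_exists\<close>).

  Two analytic facts carry this argument: the du Bois-Reymond lemma, that a continuous function with
  weak derivative \<open>0\<close> is constant (\<open>constant_if_orthogonal_to_derivs\<close>), and integration by parts
  against indefinite Lebesgue integrals (\<open>integral_indefinite_integral_times_deriv\<close>). The first one
  needs smooth functions with compact support, which are built from \<open>exp (- 1 / x)\<close>.\<close>

section \<open>Smooth functions with compact support\<close>

text \<open>Smoothness is obtained by coinduction: it suffices to embed a function into a family that is closed
  under differentiation. This avoids closed forms of higher derivatives.\<close>

lemma iterated_derivs_differentiable:
  fixes S :: "(real \<Rightarrow> real) set"
  assumes S: "\<And>f. f \<in> S \<Longrightarrow> \<exists>f'\<in>S. \<forall>t. (f has_real_derivative f' t) (at t)" and f: "f \<in> S"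
  shows "(deriv ^^ k) f differentiable at t"
proof -
  have deriv_S: "deriv g \<in> S" if "g \<in> S" for g
  proof -
    from S[OF that] obtain g' where g': "g' \<in> S" "\<And>t. (g has_real_derivative g' t) (at t)"
      by blast
    have "deriv g = g'"
      by (rule ext) (rule DERIV_imp_deriv[OF g'(2)])
    with g'(1) show ?thesis by simp
  qed
  have "(deriv ^^ k) f \<in> S"
    by (induction k) (simp_all add: f deriv_S)
  from S[OF this] show ?thesis
    using real_differentiable_def by blast
qed

text \<open>The derivatives of \<open>exp (- 1 / x)\<close>, extended by \<open>0\<close>, all have this form.\<close>

definition flat :: "real poly \<Rightarrow> real \<Rightarrow> real" where
  "flat p x = (if x > 0 then poly p (1 / x) * exp (- 1 / x) else 0)"

lemma poly_over_exp_tendsto_0: "((\<lambda>y::real. poly p y / exp y) \<longlongrightarrow> 0) at_top"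
proof -
  have "poly p y / exp y = (\<Sum>i\<le>degree p. coeff p i * (y ^ i / exp y))" for y
    by (simp add: poly_altdef sum_divide_distrib)
  moreover have "((\<lambda>y::real. \<Sum>i\<le>degree p. coeff p i * (y ^ i / exp y)) \<longlongrightarrow> (\<Sum>i\<le>degree p. coeff p i * 0)) at_top"
    by (intro tendsto_intros tendsto_power_div_exp_0)
  ultimately show ?thesis
    by simp
qed

lemma flat_tendsto_0: "(flat p \<longlongrightarrow> 0) (at 0)"
proof -
  have "((\<lambda>x. poly p (inverse x) / exp (inverse x)) \<longlongrightarrow> 0) (at_right 0)"
    by (rule filterlim_compose[OF poly_over_exp_tendsto_0 filterlim_inverse_at_top_right])
  moreover have "eventually (\<lambda>x. poly p (inverse x) / exp (inverse x) = flat p x) (at_right 0)"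
    by (auto simp: flat_def eventually_at_filter field_simps exp_minus)
  ultimately have "(flat p \<longlongrightarrow> 0) (at_right 0)"
    by (rule Lim_transform_eventually)
  moreover have "(flat p \<longlongrightarrow> 0) (at_left 0)"
    by (rule Lim_transform_eventually[OF tendsto_const])
       (auto simp: flat_def eventually_at_filter)
  ultimately show ?thesis
    by (simp add: filterlim_split_at_real)
qed

text \<open>At \<open>0\<close> the difference quotient of \<open>flat p\<close> is \<open>flat (pCons 0 p)\<close>, which tends to \<open>0\<close> since the
  exponential beats every polynomial in \<open>1 / x\<close>.\<close>

lemma flat_has_derivative:
  "(flat p has_real_derivative flat ([:0, 0, 1:] * (p - pderiv p)) x) (at x)"
proof -
  consider "x < 0" | "x = 0" | "x > 0" by linarith
  then show ?thesis
  proof cases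
    case 1
    have "((\<lambda>_. 0) has_real_derivative 0) (at x)" by simp
    then show ?thesis
      using 1 by (subst DERIV_cong_ev[OF refl _ refl, of _ "\<lambda>_. 0"])
        (auto simp: flat_def eventually_nhds intro!: exI[of _ "{..<0}"])
  next
    case 2
    have "eventually (\<lambda>h. flat (pCons 0 p) h = (flat p (0 + h) - flat p 0) / h) (at 0)"
      by (auto simp: flat_def eventually_at_filter)
    with flat_tendsto_0 have "((\<lambda>h. (flat p (0 + h) - flat p 0) / h) \<longlongrightarrow> 0) (at 0)"
      by (rule Lim_transform_eventually)
    then show ?thesis
      by (simp add: 2 DERIV_def flat_def)
  next
    case 3
    have "((\<lambda>x. poly p (1 / x) * exp (- 1 / x)) has_real_derivative
        (poly (pderiv p) (1 / x) * (- 1 / x\<^sup>2)) * exp (- 1 / x) + (exp (- 1 / x) * (1 / x\<^sup>2)) * poly p (1 / x)) (at x)"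
      using 3 by (auto intro!: derivative_eq_intros poly_DERIV[THEN DERIV_chain2] simp: power2_eq_square)
    then show ?thesis
      using 3 by (subst DERIV_cong_ev[OF refl _ refl, of _ "\<lambda>x. poly p (1 / x) * exp (- 1 / x)"])
        (auto simp: flat_def eventually_nhds algebra_simps power2_eq_square intro!: exI[of _ "{0<..}"])
  qed
qed

text \<open>Products of two functions \<open>flat\<close> are supported in \<open>[a,b]\<close>. Differentiating a product by the Leibniz
  rule gives a difference of such products, since the second factor is reflected; differences are
  therefore all that is needed for closure under differentiation.\<close>

inductive_set bumps :: "(real \<Rightarrow> real) set" where
  bump: "(\<lambda>t. flat p (t - a) * flat q (b - t)) \<in> bumps"
| diff: "f \<in> bumps \<Longrightarrow> g \<in> bumps \<Longrightarrow> (\<lambda>t. f t - g t) \<in> bumps"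

lemma bumps_derivative:
  assumes "f \<in> bumps"
  shows "\<exists>f'\<in>bumps. \<forall>t. (f has_real_derivative f' t) (at t)"
  using assms
proof induction
  case (bump p a q b)
  define D where "D p = [:0, 0, 1:] * (p - pderiv p)" for p :: "real poly"
  have D: "(flat p has_real_derivative flat (D p) x) (at x)" for p x
    unfolding D_def by (rule flat_has_derivative)
  have "((\<lambda>t. flat p (t - a) * flat q (b - t)) has_real_derivative
      flat (D p) (t - a) * flat q (b - t) - flat p (t - a) * flat (D q) (b - t)) (at t)" for t
    by (rule derivative_eq_intros D[THEN DERIV_chain2] refl)+ simp
  then show ?case
    by (intro bexI[of _ "\<lambda>t. flat (D p) (t - a) * flat q (b - t) - flat p (t - a) * flat (D q) (b - t)"]
          allI bumps.intros)
next
  case (diff f g)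
  then obtain f' g' where "f' \<in> bumps" "g' \<in> bumps"
    "\<And>t. (f has_real_derivative f' t) (at t)" "\<And>t. (g has_real_derivative g' t) (at t)"
    by blast
  then show ?case
    by (intro bexI[of _ "\<lambda>t. f' t - g' t"] allI bumps.intros DERIV_diff)
qed

lemma test_function_deriv:
  assumes "test_function T \<phi>"
  shows "test_function T (deriv \<phi>)"
proof -
  have "deriv \<phi> t = 0" if "t \<notin> closure {t. \<phi> t \<noteq> 0}" for t
  proof -
    have "eventually (\<lambda>s. \<phi> s = 0) (nhds t)"
      unfolding eventually_nhds
      by (rule exI[of _ "- closure {t. \<phi> t \<noteq> 0}"]) (use that closure_subset[of "{t. \<phi> t \<noteq> 0}"] in auto)
    then have "(\<phi> has_real_derivative 0) (at t)"
      by (subst DERIV_cong_ev[OF refl _ refl, of _ "\<lambda>_. 0"]) auto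
    then show ?thesis by (rule DERIV_imp_deriv)
  qed
  then have "closure {t. deriv \<phi> t \<noteq> 0} \<subseteq> closure {t. \<phi> t \<noteq> 0}"
    by (intro closure_minimal) auto
  moreover have "(deriv ^^ k) (deriv \<phi>) = (deriv ^^ Suc k) \<phi>" for k
    by (simp only: funpow_Suc_right o_def)
  ultimately show ?thesis
    using assms unfolding test_function_def by (metis order_trans)
qed

lemma test_function_iterated_deriv: "test_function T \<phi> \<Longrightarrow> test_function T ((deriv ^^ k) \<phi>)"
  by (induction k) (auto intro: test_function_deriv)

lemma test_function_DERIV:
  assumes "test_function T \<phi>"
  shows "(\<phi> has_real_derivative deriv \<phi> t) (at t)"
  using assms by (auto simp: test_function_def DERIV_deriv_iff_real_differentiable dest: spec[of _ 0])

lemma test_function_continuous_on: "test_function T \<phi> \<Longrightarrow> continuous_on S \<phi>"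
  by (intro continuous_at_imp_continuous_on ballI) (rule DERIV_isCont[OF test_function_DERIV])

lemma test_function_vanishes:
  assumes "test_function T \<phi>" "t \<notin> {0<..<T}"
  shows "\<phi> t = 0"
  using assms closure_subset[of "{t. \<phi> t \<noteq> 0}"] by (auto simp: test_function_def)

text \<open>The test function is \<open>R (t - a) - R (t - b)\<close>, where \<open>R\<close> is a smooth step, namely an antiderivative of a
  bump \<open>\<rho>\<close> supported in \<open>[-d,d]\<close>: left of both steps it is \<open>0 - 0\<close>, right of both it is \<open>R d - R d\<close>.\<close>

lemma translated_bump_difference:
  assumes "0 < d" "d < a" "a + d < T" "d < b" "b + d < T"
  obtains \<phi> \<rho> where "test_function T \<phi>"
    "\<And>t. deriv \<phi> t = \<rho> (t - a) - \<rho> (t - b)"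
    "\<And>t. \<rho> t \<ge> 0" "\<And>t. \<rho> t > 0 \<longleftrightarrow> \<bar>t\<bar> < d"
proof -
  define \<rho> where "\<rho> t = flat 1 (t + d) * flat 1 (d - t)" for t
  define R where "R x = integral {- d..x} \<rho>" for x
  define \<phi> where "\<phi> t = R (t - a) - R (t - b)" for t
  define \<psi> where "\<psi> t = \<rho> (t - a) - \<rho> (t - b)" for t
  have \<rho>_nonneg: "\<rho> t \<ge> 0" and \<rho>_pos: "\<rho> t > 0 \<longleftrightarrow> \<bar>t\<bar> < d" for t
    using assms by (auto simp: \<rho>_def flat_def)
  have \<rho>_bumps: "(\<lambda>t. \<rho> (t - c)) \<in> bumps" for c
    using bumps.bump[of 1 "c - d" 1 "c + d"] by (simp add: \<rho>_def algebra_simps)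
  then have cont: "continuous_on S \<rho>" for S
    using bumps_derivative[OF \<rho>_bumps[of 0]] by (force intro!: continuous_at_imp_continuous_on DERIV_isCont)
  have R_left: "R x = 0" if "x \<le> - d" for x
    using that by (cases "x = -d") (auto simp: R_def)
  have R_deriv: "(R has_real_derivative \<rho> x) (at x)" for x
  proof (cases "x > - d")
    case True
    have "(R has_real_derivative \<rho> x) (at x within {- d..x + 1})"
      unfolding R_def using True by (intro integral_has_real_derivative cont) auto
    moreover have "at x within {- d..x + 1} = at x"
      using True by (intro at_within_interior) auto
    ultimately show ?thesis by simp
  next
    case False
    show ?thesis
    proof (cases "x = - d")
      case True
      have 0: "\<rho> x = 0" using \<rho>_pos[of x] \<rho>_nonneg[of x] assms True by auto
      have "(R has_real_derivative \<rho> x) (at x within {- d..x + 1})"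
        unfolding R_def using True by (intro integral_has_real_derivative cont) auto
      moreover have "at x within {- d..x + 1} = at_right x"
        using True by (simp add: at_within_Icc_at_right)
      moreover have "((\<lambda>y. (R y - R x) / (y - x)) \<longlongrightarrow> 0) (at_left x)"
        by (rule Lim_transform_eventually[OF tendsto_const])
           (auto simp: eventually_at_filter R_left True)
      ultimately show ?thesis
        by (simp add: has_field_derivative_iff 0 filterlim_split_at_real)
    next
      case False
      with \<open>\<not> x > - d\<close> have x: "x < - d" by simp
      then have 0: "\<rho> x = 0" using \<rho>_pos[of x] \<rho>_nonneg[of x] by auto
      show ?thesis
        unfolding 0 by (subst DERIV_cong_ev[OF refl _ refl, of _ "\<lambda>_. 0"])
          (use x R_left in \<open>auto simp: eventually_nhds intro!: exI[of _ "{..<- d}"]\<close>)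
    qed
  qed
  have R_right: "R x = R d" if "x \<ge> d" for x
  proof -
    have "integral {d..x} \<rho> = integral {d..x} (\<lambda>_. 0)"
    proof (rule integral_cong)
      fix s assume "s \<in> {d..x}"
      then show "\<rho> s = 0" using \<rho>_pos[of s] \<rho>_nonneg[of s] by auto
    qed
    then show ?thesis
      using assms that Henstock_Kurzweil_Integration.integral_combine[of "- d" d x \<rho>]
      by (simp add: R_def integrable_continuous_real cont)
  qed
  have \<phi>_deriv: "(\<phi> has_real_derivative \<psi> t) (at t)" for t
    unfolding \<phi>_def \<psi>_def by (rule derivative_eq_intros R_deriv[THEN DERIV_chain2] refl)+ simp
  have \<psi>: "\<psi> \<in> bumps"
    unfolding \<psi>_def by (intro bumps.diff \<rho>_bumps)
  have "(deriv ^^ k) \<phi> differentiable at t" for k t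
  proof (rule iterated_derivs_differentiable[of "insert \<phi> bumps"])
    show "\<exists>f'\<in>insert \<phi> bumps. \<forall>t. (f has_real_derivative f' t) (at t)"
      if "f \<in> insert \<phi> bumps" for f
    proof (cases "f = \<phi>")
      case True
      then show ?thesis using \<phi>_deriv \<psi> by (intro bexI[of _ \<psi>]) simp_all
    next
      case False
      then have "f \<in> bumps" using that by simp
      from bumps_derivative[OF this] obtain f' where "f' \<in> bumps" "\<forall>t. (f has_real_derivative f' t) (at t)"
        by blast
      then show ?thesis by (intro bexI[of _ f']) simp_all
    qed
  qed simp
  moreover have vanish: "\<phi> t = 0" if "t \<notin> {min a b - d..max a b + d}" for t
  proof (cases "t < min a b - d")
    case True
    then show ?thesis by (simp add: \<phi>_def R_left)
  next
    case False
    then have "t - a \<ge> d" "t - b \<ge> d" using that by auto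
    then show ?thesis using R_right[of "t - a"] R_right[of "t - b"] by (simp add: \<phi>_def)
  qed
  have supp: "closure {t. \<phi> t \<noteq> 0} \<subseteq> {min a b - d..max a b + d}"
  proof (rule closure_minimal)
    show "{t. \<phi> t \<noteq> 0} \<subseteq> {min a b - d..max a b + d}"
    proof
      fix t assume "t \<in> {t. \<phi> t \<noteq> 0}"
      then show "t \<in> {min a b - d..max a b + d}" using vanish[of t] by fast
    qed
  qed simp
  have "{min a b - d..max a b + d} \<subseteq> {0<..<T}"
    using assms by (simp add: subset_iff min_def max_def)
  with supp have "closure {t. \<phi> t \<noteq> 0} \<subseteq> {0<..<T}"
    by (rule order_trans)
  ultimately have "test_function T \<phi>"
    by (simp add: test_function_def)
  moreover have "deriv \<phi> t = \<rho> (t - a) - \<rho> (t - b)" for t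
    using DERIV_imp_deriv[OF \<phi>_deriv[of t]] by (simp add: \<psi>_def)
  ultimately show thesis
    by (rule that[of \<phi> \<rho>, OF _ _ \<rho>_nonneg \<rho>_pos])
qed

section \<open>Square integrable functions\<close>

lemma integrable_lebesgue_on_Ioo_iff:
  fixes f :: "real \<Rightarrow> real"
  shows "integrable (lebesgue_on {a<..<b}) f \<longleftrightarrow> integrable (lebesgue_on {a..b}) f"
  using absolutely_integrable_on_Icc_iff_Ioo[where f = f and a = a and b = b]
  by (simp add: set_integrable_def integrable_restrict_space)

lemma integral_lebesgue_on_Ioo:
  fixes f :: "real \<Rightarrow> real"
  shows "integral\<^sup>L (lebesgue_on {a<..<b}) f = integral\<^sup>L (lebesgue_on {a..b}) f"
proof (cases "integrable (lebesgue_on {a..b}) f")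
  case True
  then show ?thesis
    using integrable_lebesgue_on_Ioo_iff[of a b f]
    by (simp add: lebesgue_integral_eq_integral integral_open_interval_real)
next
  case False
  then show ?thesis
    using integrable_lebesgue_on_Ioo_iff[of a b f] by (simp add: not_integrable_integral_eq)
qed

lemma L2_imp_integrable:
  assumes "u \<in> L2 T"
  shows "integrable (lebesgue_on {0..T}) u"
proof -
  have "finite_measure (lebesgue_on {0<..<T})"
    by (rule finite_measure_lebesgue_on) simp
  then interpret finite_measure "lebesgue_on {0<..<T}" .
  have "integrable (lebesgue_on {0<..<T}) (\<lambda>t. 1 + (u t)\<^sup>2)"
    using assms by (simp add: L2_def)
  moreover have "\<bar>x\<bar> \<le> \<bar>1 + x\<^sup>2\<bar>" for x :: real
    using zero_le_power2[of "\<bar>x\<bar> - 1"] by (simp add: power2_diff)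
  ultimately have "integrable (lebesgue_on {0<..<T}) u"
    using assms by (elim Bochner_Integration.integrable_bound) (auto simp: L2_def)
  then show ?thesis
    by (simp add: integrable_lebesgue_on_Ioo_iff)
qed

lemma L2_add:
  assumes "u \<in> L2 T" "v \<in> L2 T"
  shows "(\<lambda>t. u t + v t) \<in> L2 T"
proof -
  have "integrable (lebesgue_on {0<..<T}) (\<lambda>t. 2 * (u t)\<^sup>2 + 2 * (v t)\<^sup>2)"
    using assms by (simp add: L2_def)
  moreover have "(x + y)\<^sup>2 \<le> 2 * x\<^sup>2 + 2 * y\<^sup>2" for x y :: real
    using zero_le_power2[of "x - y"] by (simp add: power2_eq_square algebra_simps)
  ultimately have "integrable (lebesgue_on {0<..<T}) (\<lambda>t. (u t + v t)\<^sup>2)"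
    using assms by (elim Bochner_Integration.integrable_bound) (auto simp: L2_def)
  then show ?thesis
    using assms by (auto simp: L2_def)
qed

lemma L2_cmult: "u \<in> L2 T \<Longrightarrow> (\<lambda>t. c * u t) \<in> L2 T"
  by (auto simp: L2_def power_mult_distrib)

lemma L2_diff: "u \<in> L2 T \<Longrightarrow> v \<in> L2 T \<Longrightarrow> (\<lambda>t. u t - v t) \<in> L2 T"
  using L2_add[of u T "\<lambda>t. - 1 * v t"] L2_cmult[of v T "- 1"] by simp

lemma continuous_imp_L2:
  assumes "continuous_on {0..T} f"
  shows "f \<in> L2 T"
proof -
  have "f \<in> borel_measurable (lebesgue_on {0<..<T})"
    by (rule continuous_imp_measurable_on_sets_lebesgue)
       (auto intro: continuous_on_subset[OF assms])
  moreover have "integrable (lebesgue_on {0<..<T}) (\<lambda>t. (f t)\<^sup>2)"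
    unfolding integrable_lebesgue_on_Ioo_iff
    by (intro continuous_imp_integrable_real continuous_intros assms)
  ultimately show ?thesis
    by (simp add: L2_def)
qed

lemma integrable_mult_continuous:
  fixes g \<phi> :: "real \<Rightarrow> real"
  assumes g: "integrable (lebesgue_on {a..b}) g" and \<phi>: "continuous_on {a..b} \<phi>"
  shows "integrable (lebesgue_on {a..b}) (\<lambda>t. g t * \<phi> t)"
proof -
  have "bounded (\<phi> ` {a..b})"
    by (intro compact_imp_bounded compact_continuous_image \<phi>) simp
  then obtain K where K: "\<And>t. t \<in> {a..b} \<Longrightarrow> \<bar>\<phi> t\<bar> \<le> K"
    unfolding bounded_iff by (metis imageI real_norm_def)
  have [measurable]: "\<phi> \<in> borel_measurable (lebesgue_on {a..b})"
    by (intro continuous_imp_measurable_on_sets_lebesgue \<phi>) simp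
  note [measurable] = borel_measurable_integrable[OF g]
  have "AE t in lebesgue_on {a..b}. norm (g t * \<phi> t) \<le> norm (K * \<bar>g t\<bar>)"
  proof (rule AE_I2)
    fix t assume "t \<in> space (lebesgue_on {a..b})"
    then have "\<bar>\<phi> t\<bar> \<le> \<bar>K\<bar>" using K[of t] by simp
    then show "norm (g t * \<phi> t) \<le> norm (K * \<bar>g t\<bar>)"
      by (simp add: abs_mult mult.commute[of "\<bar>g t\<bar>"] mult_right_mono)
  qed
  then show ?thesis
    by (rule Bochner_Integration.integrable_bound[rotated 2]) (use g in auto)
qed

section \<open>Integration by parts and the du Bois-Reymond lemma\<close>

text \<open>Since \<open>g\<close> is merely integrable, its indefinite integral is differentiable only almost everywhere, and
  the classical rule of integration by parts does not apply. Instead, Fubini's theorem is used on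
  \<open>g s * deriv \<phi> t\<close> over the triangle \<open>s \<le> t\<close>.\<close>

lemma integral_indefinite_integral_times_deriv:
  assumes g: "integrable (lebesgue_on {0..T}) g" and \<phi>: "test_function T \<phi>"
  shows "(LINT t|lebesgue_on {0..T}. (LINT s|lebesgue_on {0..t}. g s) * deriv \<phi> t) =
    - (LINT t|lebesgue_on {0..T}. g t * \<phi> t)"
proof -
  define M where "M = lebesgue_on {0..T}"
  have "finite_measure M"
    unfolding M_def by (rule finite_measure_lebesgue_on) simp
  then interpret M: finite_measure M .
  interpret MM: pair_sigma_finite M M ..
  have space_M: "space M = {0..T}" by (simp add: M_def)
  define \<phi>' where "\<phi>' = deriv \<phi>"
  have \<phi>'_cont: "continuous_on S \<phi>'" for S
    unfolding \<phi>'_def by (rule test_function_continuous_on[OF test_function_deriv[OF \<phi>]])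
  have "bounded (\<phi>' ` {0..T})"
    by (intro compact_imp_bounded compact_continuous_image \<phi>'_cont) simp
  then obtain K where K: "\<And>t. t \<in> {0..T} \<Longrightarrow> \<bar>\<phi>' t\<bar> \<le> K"
    unfolding bounded_iff by (metis imageI real_norm_def)
  have [measurable]: "\<phi>' \<in> borel_measurable M"
    unfolding M_def by (intro continuous_imp_measurable_on_sets_lebesgue \<phi>'_cont) simp
  have [measurable]: "(\<lambda>x. x) \<in> borel_measurable M"
    unfolding M_def by (intro continuous_imp_measurable_on_sets_lebesgue) auto
  have gM: "integrable M g" using g by (simp add: M_def)
  note [measurable] = borel_measurable_integrable[OF gM]
  define F where "F t s = (if s \<le> t then g s * \<phi>' t else 0)" for t s
  have [measurable]: "case_prod F \<in> borel_measurable (M \<Otimes>\<^sub>M M)"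
    unfolding F_def by measurable
  have "integrable (M \<Otimes>\<^sub>M M) (\<lambda>x. K * \<bar>g (snd x)\<bar>)"
    by (rule MM.Fubini_integrable) (use gM in auto)
  then have F_int: "integrable (M \<Otimes>\<^sub>M M) (case_prod F)"
  proof (rule Bochner_Integration.integrable_bound)
    show "AE x in M \<Otimes>\<^sub>M M. norm (case_prod F x) \<le> norm (K * \<bar>g (snd x)\<bar>)"
    proof (rule AE_I2)
      fix x assume "x \<in> space (M \<Otimes>\<^sub>M M)"
      then have "fst x \<in> {0..T}" by (auto simp: space_pair_measure M_def)
      from K[OF this] have "\<bar>\<phi>' (fst x)\<bar> \<le> \<bar>K\<bar>" by simp
      then show "norm (case_prod F x) \<le> norm (K * \<bar>g (snd x)\<bar>)"
        by (auto simp: F_def split_beta abs_mult mult.commute[of "\<bar>g (snd x)\<bar>"] mult_right_mono)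
    qed
  qed simp
  have inner_s: "(LINT s|M. F t s) = (LINT s|lebesgue_on {0..t}. g s) * \<phi>' t" if t: "t \<in> {0..T}" for t
  proof -
    have "indicat_real {0..T} s *\<^sub>R F t s = indicator {0..t} s * g s * \<phi>' t" for s
      using t by (simp add: F_def indicator_def)
    then have "(LINT s|M. F t s) = (LINT s|lebesgue. indicator {0..t} s * g s * \<phi>' t)"
      by (simp add: M_def integral_restrict_space del: real_scaleR_def)
    then show ?thesis
      by (simp add: integral_restrict_space)
  qed
  have inner_t: "(LINT t|M. F t s) = - (g s * \<phi> s)" if s: "s \<in> {0..T}" for s
  proof -
    have "indicat_real {0..T} t *\<^sub>R F t s = g s * (indicator {s..T} t * \<phi>' t)" for t
      using s by (simp add: F_def indicator_def)
    then have "(LINT t|M. F t s) = (LINT t|lebesgue. g s * (indicator {s..T} t * \<phi>' t))"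
      by (simp add: M_def integral_restrict_space del: real_scaleR_def)
    also have "\<dots> = g s * (LINT t|lebesgue_on {s..T}. \<phi>' t)"
      by (simp add: integral_restrict_space)
    also have "(LINT t|lebesgue_on {s..T}. \<phi>' t) = integral {s..T} \<phi>'"
      by (intro lebesgue_integral_eq_integral continuous_imp_integrable_real \<phi>'_cont) simp
    also have "integral {s..T} \<phi>' = \<phi> T - \<phi> s"
      by (intro integral_unique fundamental_theorem_of_calculus)
         (use s in \<open>auto simp: \<phi>'_def has_real_derivative_iff_has_vector_derivative[symmetric]
            intro: has_field_derivative_at_within test_function_DERIV[OF \<phi>]\<close>)
    finally show ?thesis
      using test_function_vanishes[OF \<phi>, of T] by simp
  qed
  have "(LINT t|M. (LINT s|lebesgue_on {0..t}. g s) * \<phi>' t) = (LINT t|M. LINT s|M. F t s)"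
    by (intro Bochner_Integration.integral_cong) (simp_all add: inner_s space_M)
  also have "\<dots> = (LINT s|M. LINT t|M. F t s)"
    using MM.integral_fst[OF F_int] MM.integral_snd[OF F_int] by simp
  also have "\<dots> = (LINT s|M. - (g s * \<phi> s))"
    by (intro Bochner_Integration.integral_cong) (simp_all add: inner_t space_M)
  finally show ?thesis
    by (simp add: M_def \<phi>'_def)
qed

text \<open>If \<open>h a < h b\<close>, then \<open>h\<close> lies below some level \<open>m\<close> near \<open>a\<close> and above \<open>m\<close> near \<open>b\<close>. A test function whose
  derivative is a bump at \<open>a\<close> minus a bump at \<open>b\<close> then makes \<open>(m - h) \<phi>'\<close> nonnegative and positive at
  \<open>a\<close>, although its integral is zero.\<close>

lemma constant_if_orthogonal_to_derivs:
  assumes h: "continuous_on {0..T} h"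
    and orth: "\<And>\<phi>. test_function T \<phi> \<Longrightarrow> (LINT t|lebesgue_on {0..T}. h t * deriv \<phi> t) = 0"
    and t: "t \<in> {0..T}"
  shows "h t = h 0"
proof -
  have not_less: "\<not> h a < h b" if a: "a \<in> {0<..<T}" and b: "b \<in> {0<..<T}" for a b
  proof
    assume less: "h a < h b"
    \<comment> \<open>Any level strictly between the two values.\<close>
    define m where "m = (h a + h b) / 2"
    have "isCont h a" "isCont h b"
      using a b h continuous_on_interior[of "{0..T}" h] by auto
    then have "(h \<longlongrightarrow> h a) (nhds a)" "(h \<longlongrightarrow> h b) (nhds b)"
      by (simp_all add: isCont_def tendsto_at_iff_tendsto_nhds)
    then have "eventually (\<lambda>t. h t < m) (nhds a)" "eventually (\<lambda>t. h t > m) (nhds b)"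
      using less order_tendstoD(2)[of h "h a" "nhds a" m] order_tendstoD(1)[of h "h b" "nhds b" m]
      by (simp_all add: m_def)
    then obtain d1 d2 where d1: "d1 > 0" "\<And>t. \<bar>t - a\<bar> < d1 \<Longrightarrow> h t < m"
      and d2: "d2 > 0" "\<And>t. \<bar>t - b\<bar> < d2 \<Longrightarrow> h t > m"
      unfolding eventually_nhds_metric dist_real_def by blast
    define d where "d = Min {d1, d2, a / 2, b / 2, (T - a) / 2, (T - b) / 2}"
    have d: "0 < d" "d \<le> d1" "d \<le> d2" "d < a" "a + d < T" "d < b" "b + d < T"
    proof -
      show "0 < d" unfolding d_def by (subst Min_gr_iff) (use d1(1) d2(1) a b in auto)
      have le: "d \<le> x" if "x \<in> {d1, d2, a / 2, b / 2, (T - a) / 2, (T - b) / 2}" for x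
        unfolding d_def by (rule Min_le[OF _ that]) simp
      have "d \<le> a / 2" "d \<le> b / 2" "d \<le> (T - a) / 2" "d \<le> (T - b) / 2"
        by (rule le; simp)+
      then show "d < a" "a + d < T" "d < b" "b + d < T" using a b by auto
      show "d \<le> d1" "d \<le> d2" by (rule le; simp)+
    qed
    obtain \<phi> \<rho> where \<phi>: "test_function T \<phi>"
      and \<phi>_deriv: "\<And>t. deriv \<phi> t = \<rho> (t - a) - \<rho> (t - b)"
      and \<rho>_nonneg: "\<And>t. \<rho> t \<ge> 0" and \<rho>_pos: "\<And>t. \<rho> t > 0 \<longleftrightarrow> \<bar>t\<bar> < d"
    proof (rule translated_bump_difference[OF d(1,4-7)])
      fix \<phi> \<rho> assume "test_function T \<phi>" "\<And>t. deriv \<phi> t = \<rho> (t - a) - \<rho> (t - b)"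
        "\<And>t. \<rho> t \<ge> 0" "\<And>t. \<rho> t > 0 \<longleftrightarrow> \<bar>t\<bar> < d"
      then show thesis by (rule that[of \<phi> \<rho>])
    qed
    have \<phi>'_cont: "continuous_on S (deriv \<phi>)" for S
      by (rule test_function_continuous_on[OF test_function_deriv[OF \<phi>]])
    define q where "q t = (m - h t) * deriv \<phi> t" for t
    have q_cont: "continuous_on {0..T} q"
      unfolding q_def by (intro continuous_intros h \<phi>'_cont)
    have q_nonneg: "q t \<ge> 0" for t
    proof -
      have "(m - h t) * \<rho> (t - a) \<ge> 0"
        using d1(2)[of t] d(2) \<rho>_pos[of "t - a"] \<rho>_nonneg[of "t - a"]
        by (cases "\<rho> (t - a) = 0") auto
      moreover have "(m - h t) * \<rho> (t - b) \<le> 0"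
        using d2(2)[of t] d(3) \<rho>_pos[of "t - b"] \<rho>_nonneg[of "t - b"]
        by (cases "\<rho> (t - b) = 0") (auto simp: mult_le_0_iff)
      ultimately show ?thesis
        by (simp add: q_def \<phi>_deriv algebra_simps)
    qed
    have int_deriv: "(LINT t|lebesgue_on {0..T}. deriv \<phi> t) = 0"
    proof -
      have "(LINT t|lebesgue_on {0..T}. deriv \<phi> t) = integral {0..T} (deriv \<phi>)"
        by (intro lebesgue_integral_eq_integral continuous_imp_integrable_real \<phi>'_cont) simp
      also have "\<dots> = \<phi> T - \<phi> 0"
        by (intro integral_unique fundamental_theorem_of_calculus)
           (use a in \<open>auto simp: has_real_derivative_iff_has_vector_derivative[symmetric]
              intro: has_field_derivative_at_within test_function_DERIV[OF \<phi>]\<close>)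
      finally show ?thesis
        using test_function_vanishes[OF \<phi>, of 0] test_function_vanishes[OF \<phi>, of T] by simp
    qed
    have "(LINT t|lebesgue_on {0..T}. q t) =
        (LINT t|lebesgue_on {0..T}. m * deriv \<phi> t) - (LINT t|lebesgue_on {0..T}. h t * deriv \<phi> t)"
      unfolding q_def left_diff_distrib
      by (intro Bochner_Integration.integral_diff continuous_imp_integrable_real continuous_intros h \<phi>'_cont)
    also have "\<dots> = 0"
      using orth[OF \<phi>] int_deriv by simp
    finally have "\<forall>t\<in>{0..T}. q t = 0"
      using integralL_eq_0_iff[OF q_cont _ q_nonneg] a by auto
    then have q_zero: "q a = 0" "q b = 0" using a b by auto
    moreover have "q a > 0"
    proof -
      have "\<rho> (a - b) = 0"
      proof (rule ccontr)
        assume "\<rho> (a - b) \<noteq> 0"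
        then have "\<bar>a - b\<bar> < d" using \<rho>_pos \<rho>_nonneg[of "a - b"] by force
        then have "h a > m" using d2(2)[of a] d(3) by auto
        then show False using less by (simp add: m_def)
      qed
      then have "deriv \<phi> a > 0" using \<rho>_pos[of 0] d(1) by (simp add: \<phi>_deriv)
      then show ?thesis using less by (simp add: q_def m_def)
    qed
    ultimately show False by simp
  qed
  show ?thesis
  proof (cases "T > 0")
    case True
    have inside: "h t = h (T / 2)" if "t \<in> {0<..<T}" for t
      using not_less[of t "T / 2"] not_less[of "T / 2" t] that True by fastforce
    have closure: "closure {0<..<T} = {0..T}"
      using True by simp
    have everywhere: "h t = h (T / 2)" if "t \<in> {0..T}" for t
      by (rule continuous_constant_on_closure[of "{0<..<T}" h "h (T / 2)" t, OF _ inside]) (use h that in \<open>simp_all add: closure\<close>)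
    show ?thesis
      using everywhere[OF t] everywhere[of 0] True by simp
  next
    case False
    then have "t = 0" using t by simp
    then show ?thesis by simp
  qed
qed

text \<open>By integration by parts the indefinite integral of \<open>h\<close> is orthogonal to all derivatives of test
  functions, hence constant.\<close>

lemma integral_zero_if_orthogonal:
  assumes h: "integrable (lebesgue_on {0..T}) h"
    and orth: "\<And>\<phi>. test_function T \<phi> \<Longrightarrow> (LINT t|lebesgue_on {0..T}. h t * \<phi> t) = 0"
    and t: "t \<in> {0..T}"
  shows "(LINT s|lebesgue_on {0..t}. h s) = 0"
proof -
  have "(LINT s|lebesgue_on {0..t}. h s) = (LINT s|lebesgue_on {0..0}. h s)"
  proof (rule constant_if_orthogonal_to_derivs[of T "\<lambda>t. LINT s|lebesgue_on {0..t}. h s"])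
    show "continuous_on {0..T} (\<lambda>t. LINT s|lebesgue_on {0..t}. h s)"
      by (rule indefinite_integral_continuous_real[OF h])
  qed (use t orth integral_indefinite_integral_times_deriv[OF h] in auto)
  also have "\<dots> = 0"
  proof -
    have "integrable (lebesgue_on {0..0}) h"
      by (rule integrable_subinterval[OF h]) (use t in auto)
    then show ?thesis by (simp add: lebesgue_integral_eq_integral)
  qed
  finally show ?thesis .
qed

section \<open>Functions with vanishing indefinite integral\<close>

text \<open>After passing to a Borel representative, the positive and the negative part of \<open>g\<close> are densities of
  two finite measures that agree on all rays \<open>{x<..}\<close>. Such measures are equal, and so are their
  densities almost everywhere.\<close>

lemma AE_zero_if_indefinite_integral_zero:
  fixes g :: "real \<Rightarrow> real"
  assumes g: "integrable (lebesgue_on {0..T}) g"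
    and zero: "\<And>t. t \<in> {0..T} \<Longrightarrow> (LINT s|lebesgue_on {0..t}. g s) = 0"
  shows "AE t in lebesgue_on {0..T}. g t = 0"
proof -
  define f where "f t = indicator {0..T} t * g t" for t
  have f: "integrable lebesgue f"
    using g by (simp add: f_def[abs_def] integrable_restrict_space)
  obtain f' where f'[measurable]: "f' \<in> borel_measurable lborel" and ff': "AE t in lborel. f t = f' t"
    using completion_ex_borel_measurable_real[of f lborel] f by auto
  have ff'_leb: "AE t in lebesgue. f t = f' t"
    using ff' by (rule AE_completion)
  have f'_leb[measurable]: "f' \<in> borel_measurable lebesgue"
    using f' by (rule measurable_completion)
  have "integrable lebesgue f'"
    using f integrable_cong_AE[of f lebesgue f'] ff'_leb by auto
  then have f'_int: "integrable lborel f'"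
    using f' by (simp add: integrable_completion)
  have f_tail: "(LINT t|lebesgue. indicator {x<..} t * f t) = 0" for x
  proof -
    have empty: "(LINT t|lebesgue. f t) = 0"
    proof (cases "T \<ge> 0")
      case True
      then show ?thesis
        using zero[of T] by (simp add: f_def integral_restrict_space)
    qed (simp add: f_def)
    consider "x < 0" | "x \<ge> 0" "x \<le> T" | "x > T" by linarith
    then show ?thesis
    proof cases
      case 1
      then have "indicat_real {x<..} t * f t = f t" for t
        by (simp add: f_def indicator_def)
      then show ?thesis by (simp only: empty)
    next
      case 2
      then have "indicator {x<..} t * f t = f t - indicator {0..x} t * g t" for t
        by (simp add: f_def indicator_def)
      moreover have "integrable lebesgue (\<lambda>t. indicator {0..x} t * g t)"
        using integrable_subinterval[OF g, of 0 x] 2 by (simp add: integrable_restrict_space)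
      moreover have "(LINT t|lebesgue. indicator {0..x} t * g t) = 0"
        using zero[of x] 2 by (simp add: integral_restrict_space)
      ultimately show ?thesis using f empty by simp
    next
      case 3
      then have "indicat_real {x<..} t * f t = 0" for t
        by (simp add: f_def indicator_def)
      then show ?thesis by (simp only: Bochner_Integration.integral_zero)
    qed
  qed
  have f'_tail: "(LINT t|lborel. indicator {x<..} t * f' t) = 0" for x
  proof -
    have "(LINT t|lborel. indicator {x<..} t * f' t) = (LINT t|lebesgue. indicator {x<..} t * f' t)"
      by (rule integral_completion[symmetric]) simp
    also have "\<dots> = (LINT t|lebesgue. indicator {x<..} t * f t)"
    proof (rule integral_cong_AE)
      have "indicat_real {x<..} \<in> borel_measurable lebesgue"
        by (intro borel_measurable_indicator) simp
      then show "(\<lambda>t. indicat_real {x<..} t * f' t) \<in> borel_measurable lebesgue"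
        "(\<lambda>t. indicat_real {x<..} t * f t) \<in> borel_measurable lebesgue"
        using f'_leb borel_measurable_integrable[OF f] by (auto intro: borel_measurable_times)
    qed (use ff'_leb in auto)
    finally show ?thesis by (simp add: f_tail)
  qed
  have tail_int: "integrable lborel (\<lambda>t. indicator {x<..} t * max 0 (s * f' t))" for x s :: real
  proof -
    have "integrable lborel (\<lambda>t. max 0 (s * f' t))"
      by (intro integrable_max integrable_mult_right) (use f'_int in auto)
    then have "integrable lborel (\<lambda>t. max 0 (s * f' t) * indicator {x<..} t)"
      by (intro integrable_real_mult_indicator) auto
    then show ?thesis by (simp only: mult.commute)
  qed
  have emeasure_tail: "emeasure (density lborel (\<lambda>t. ennreal (s * f' t))) {x<..} =
      ennreal (LINT t|lborel. indicator {x<..} t * max 0 (s * f' t))" for s x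
  proof -
    have "emeasure (density lborel (\<lambda>t. ennreal (s * f' t))) {x<..} =
        (\<integral>\<^sup>+t. ennreal (s * f' t) * indicator {x<..} t \<partial>lborel)"
      by (intro emeasure_density) auto
    also have "\<dots> = (\<integral>\<^sup>+t. ennreal (indicator {x<..} t * max 0 (s * f' t)) \<partial>lborel)"
      by (intro nn_integral_cong) (auto simp: indicator_def max_def ennreal_neg)
    also have "\<dots> = ennreal (LINT t|lborel. indicator {x<..} t * max 0 (s * f' t))"
      by (intro nn_integral_eq_integral tail_int) auto
    finally show ?thesis .
  qed
  have "density lborel (\<lambda>t. ennreal (1 * f' t)) = density lborel (\<lambda>t. ennreal (- 1 * f' t))"
  proof (rule measure_eqI_lessThan)
    fix x
    have "(LINT t|lborel. indicator {x<..} t * max 0 (1 * f' t)) - (LINT t|lborel. indicator {x<..} t * max 0 (- 1 * f' t))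
      = (LINT t|lborel. indicator {x<..} t * max 0 (1 * f' t) - indicator {x<..} t * max 0 (- 1 * f' t))"
      by (rule Bochner_Integration.integral_diff[symmetric]) (rule tail_int)+
    also have "\<dots> = (LINT t|lborel. indicator {x<..} t * f' t)"
      by (intro Bochner_Integration.integral_cong) (auto simp: indicator_def max_def)
    finally have "(LINT t|lborel. indicator {x<..} t * max 0 (1 * f' t)) = (LINT t|lborel. indicator {x<..} t * max 0 (- 1 * f' t))"
      by (simp only: f'_tail)
    then show "emeasure (density lborel (\<lambda>t. ennreal (1 * f' t))) {x<..} = emeasure (density lborel (\<lambda>t. ennreal (- 1 * f' t))) {x<..}"
      by (simp only: emeasure_tail)
    show "emeasure (density lborel (\<lambda>t. ennreal (1 * f' t))) {x<..} < \<infinity>"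
      by (simp only: emeasure_tail) simp
  qed auto
  then have "AE t in lborel. ennreal (1 * f' t) = ennreal (- 1 * f' t)"
    by (intro sigma_finite_measure.density_unique[OF sigma_finite_lborel]) auto
  then have "AE t in lborel. f t = 0"
    using ff'
  proof eventually_elim
    case (elim t)
    then show ?case by (cases "f' t \<ge> 0") (auto simp: ennreal_neg)
  qed
  then have "AE t in lebesgue. f t = 0"
    by (rule AE_completion)
  then show ?thesis
    by (subst AE_restrict_space_iff) (auto simp: f_def elim!: eventually_mono)
qed

section \<open>Weak derivatives\<close>

text \<open>Such a function is constant, and its integral over \<open>[0,T]\<close> is zero.\<close>

lemma continuous_zero_if_orthogonal:
  assumes h: "continuous_on {0..T} h" and "0 < T"
    and orth: "\<And>\<phi>. test_function T \<phi> \<Longrightarrow> (LINT t|lebesgue_on {0..T}. h t * \<phi> t) = 0"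
    and t: "t \<in> {0..T}"
  shows "h t = 0"
proof -
  have const: "h s = h 0" if "s \<in> {0..T}" for s
    by (rule constant_if_orthogonal_to_derivs[OF h _ that]) (intro orth test_function_deriv)
  have "0 = (LINT s|lebesgue_on {0..T}. h s)"
    by (rule integral_zero_if_orthogonal[OF continuous_imp_integrable_real[OF h] orth, symmetric])
       (use \<open>0 < T\<close> in auto)
  also have "\<dots> = integral {0..T} h"
    by (intro lebesgue_integral_eq_integral continuous_imp_integrable_real h) simp
  also have "\<dots> = integral {0..T} (\<lambda>_. h 0)"
    by (rule integral_cong) (rule const)
  also have "\<dots> = T * h 0"
    using \<open>0 < T\<close> by simp
  finally show ?thesis
    using const[OF t] \<open>0 < T\<close> by simp
qed

lemma weak_derivative_test:
  assumes "weak_derivative T k f g" "test_function T \<phi>"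
  shows "(LINT t|lebesgue_on {0..T}. f t * (deriv ^^ k) \<phi> t) =
    (-1) ^ k * (LINT t|lebesgue_on {0..T}. g t * \<phi> t)"
  using assms by (simp add: weak_derivative_def integral_lebesgue_on_Ioo)

lemma L2_times_test_integrable:
  assumes "u \<in> L2 T" "test_function T \<phi>"
  shows "integrable (lebesgue_on {0..T}) (\<lambda>t. u t * \<phi> t)"
  by (rule integrable_mult_continuous[OF L2_imp_integrable[OF assms(1)] test_function_continuous_on[OF assms(2)]])

lemma weak_derivative_diff:
  assumes "weak_derivative T k f g" "weak_derivative T k f' g'"
  shows "weak_derivative T k (\<lambda>t. f t - f' t) (\<lambda>t. g t - g' t)"
proof -
  have L2: "f \<in> L2 T" "g \<in> L2 T" "f' \<in> L2 T" "g' \<in> L2 T"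
    using assms by (auto simp: weak_derivative_def)
  have split: "(LINT t|lebesgue_on {0..T}. (u t - v t) * \<phi> t) =
      (LINT t|lebesgue_on {0..T}. u t * \<phi> t) - (LINT t|lebesgue_on {0..T}. v t * \<phi> t)"
    if "u \<in> L2 T" "v \<in> L2 T" "test_function T \<phi>" for u v \<phi>
    unfolding left_diff_distrib
    by (intro Bochner_Integration.integral_diff L2_times_test_integrable that)
  have "(LINT t|lebesgue_on {0..T}. (f t - f' t) * (deriv ^^ k) \<phi> t) =
      (-1) ^ k * (LINT t|lebesgue_on {0..T}. (g t - g' t) * \<phi> t)" if \<phi>: "test_function T \<phi>" for \<phi>
    using weak_derivative_test[OF assms(1) \<phi>] weak_derivative_test[OF assms(2) \<phi>]
    by (simp add: split[OF L2(1,3) test_function_iterated_deriv[OF \<phi>]] split[OF L2(2,4) \<phi>] right_diff_distrib)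
  then show ?thesis
    using L2 by (simp add: weak_derivative_def L2_diff integral_lebesgue_on_Ioo)
qed

lemma weak_derivative_unique:
  assumes f: "weak_derivative T k f g" and f': "weak_derivative T k f' g'"
    and eq: "\<And>t. t \<in> {0..T} \<Longrightarrow> f t = f' t"
  shows "AE t in lebesgue_on {0<..<T}. g t = g' t"
proof -
  have w: "weak_derivative T k (\<lambda>t. f t - f' t) (\<lambda>t. g t - g' t)"
    by (rule weak_derivative_diff[OF f f'])
  then have int: "integrable (lebesgue_on {0..T}) (\<lambda>t. g t - g' t)"
    by (intro L2_imp_integrable) (simp add: weak_derivative_def)
  have "(LINT t|lebesgue_on {0..T}. (g t - g' t) * \<phi> t) = 0" if "test_function T \<phi>" for \<phi>
  proof -
    have "(LINT t|lebesgue_on {0..T}. (f t - f' t) * (deriv ^^ k) \<phi> t) = (LINT t|lebesgue_on {0..T}. 0)"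
      by (rule Bochner_Integration.integral_cong) (simp_all add: eq)
    with weak_derivative_test[OF w that] show ?thesis by simp
  qed
  from integral_zero_if_orthogonal[OF int this]
  have "AE t in lebesgue_on {0..T}. g t - g' t = 0"
    by (rule AE_zero_if_indefinite_integral_zero[OF int])
  then show ?thesis
    by (simp add: AE_restrict_space_iff) (auto elim!: eventually_mono)
qed

lemma weak_derivative_0: "f \<in> L2 T \<Longrightarrow> weak_derivative T 0 f f"
  by (simp add: weak_derivative_def)

text \<open>Weak derivatives of functions given as iterated indefinite integrals are found one order at a time.\<close>

lemma weak_derivative_Suc:
  assumes f: "weak_derivative T k f G" and g: "g \<in> L2 T"
    and G: "\<And>t. t \<in> {0..T} \<Longrightarrow> G t = (LINT s|lebesgue_on {0..t}. g s)"
  shows "weak_derivative T (Suc k) f g"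
proof -
  have "(LINT t|lebesgue_on {0..T}. f t * (deriv ^^ Suc k) \<phi> t) =
      (-1) ^ Suc k * (LINT t|lebesgue_on {0..T}. g t * \<phi> t)" if \<phi>: "test_function T \<phi>" for \<phi>
  proof -
    have "(LINT t|lebesgue_on {0..T}. f t * (deriv ^^ Suc k) \<phi> t) =
        (-1) ^ k * (LINT t|lebesgue_on {0..T}. G t * deriv \<phi> t)"
      using weak_derivative_test[OF f test_function_deriv[OF \<phi>]]
      by (simp only: funpow_Suc_right o_def)
    also have "(LINT t|lebesgue_on {0..T}. G t * deriv \<phi> t) =
        (LINT t|lebesgue_on {0..T}. (LINT s|lebesgue_on {0..t}. g s) * deriv \<phi> t)"
      by (rule Bochner_Integration.integral_cong) (simp_all add: G)
    also have "\<dots> = - (LINT t|lebesgue_on {0..T}. g t * \<phi> t)"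
      by (rule integral_indefinite_integral_times_deriv[OF L2_imp_integrable[OF g] \<phi>])
    finally show ?thesis by simp
  qed
  then show ?thesis
    using f g by (simp add: weak_derivative_def integral_lebesgue_on_Ioo del: funpow.simps)
qed

text \<open>The \<open>k\<close>-th weak derivative of the difference \<open>h\<close> has a continuous representative \<open>hk\<close> with \<open>hk 0 = 0\<close>. If
  the derivative of order \<open>k + 1\<close> vanishes, then \<open>hk\<close> is constant, hence zero. Descending from \<open>k = r\<close> to
  \<open>k = 0\<close> shows that \<open>h\<close> is orthogonal to all test functions.\<close>

lemma sobolev0_determined_by_weak_derivative:
  assumes f: "f \<in> sobolev0 r T" and y: "y \<in> sobolev0 r T" and "0 < r" "0 < T"
    and g: "weak_derivative T r f g" and w: "weak_derivative T r y w"
    and eq: "AE t in lebesgue_on {0<..<T}. g t = w t"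
    and t: "t \<in> {0..T}"
  shows "f t = y t"
proof -
  define h where "h t = f t - y t" for t
  have h_derivs: "\<exists>hk. weak_derivative T k h hk \<and> continuous_on {0..T} hk \<and> hk 0 = 0" if k: "k < r" for k
  proof -
    obtain fk yk where fk: "weak_derivative T k f fk" "continuous_on {0..T} fk" "fk 0 = 0"
      and yk: "weak_derivative T k y yk" "continuous_on {0..T} yk" "yk 0 = 0"
      using f y k unfolding sobolev0_def by blast
    have "weak_derivative T k h (\<lambda>t. fk t - yk t)"
      unfolding h_def by (rule weak_derivative_diff[OF fk(1) yk(1)])
    then show ?thesis
      using fk yk by (intro exI[of _ "\<lambda>t. fk t - yk t"]) (auto intro: continuous_intros)
  qed
  \<comment> \<open>Counting the descent upwards: \<open>m\<close> is the number of orders already removed.\<close>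
  have "(LINT t|lebesgue_on {0..T}. h t * (deriv ^^ (r - m)) \<phi> t) = 0"
    if "m \<le> r" "test_function T \<phi>" for m \<phi>
    using that
  proof (induction m arbitrary: \<phi>)
    case 0
    have h: "weak_derivative T r h (\<lambda>t. g t - w t)"
      unfolding h_def by (rule weak_derivative_diff[OF g w])
    have "(LINT t|lebesgue_on {0<..<T}. (g t - w t) * \<phi> t) = 0"
      by (rule integral_eq_zero_AE) (use eq in eventually_elim, simp)
    with weak_derivative_test[OF h 0(2)] show ?case
      by (simp add: integral_lebesgue_on_Ioo)
  next
    case (Suc m)
    define k where "k = r - Suc m"
    have k: "k < r" "r - m = Suc k" using Suc.prems by (auto simp: k_def)
    obtain hk where hk: "weak_derivative T k h hk" "continuous_on {0..T} hk" "hk 0 = 0"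
      using h_derivs[OF k(1)] by blast
    have "(LINT t|lebesgue_on {0..T}. hk t * deriv \<psi> t) = 0" if \<psi>: "test_function T \<psi>" for \<psi>
    proof -
      have "(LINT t|lebesgue_on {0..T}. h t * (deriv ^^ Suc k) \<psi> t) = 0"
        using Suc.IH[OF _ \<psi>] Suc.prems by (simp only: k)
      then show ?thesis
        using weak_derivative_test[OF hk(1) test_function_deriv[OF \<psi>]]
        by (simp only: funpow_Suc_right o_def) simp
    qed
    then have "hk t = 0" if "t \<in> {0..T}" for t
      using constant_if_orthogonal_to_derivs[OF hk(2) _ that] hk(3) by simp
    then have "(LINT t|lebesgue_on {0..T}. hk t * \<phi> t) = (LINT t|lebesgue_on {0..T}. 0)"
      by (intro Bochner_Integration.integral_cong) simp_all
    then show ?case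
      using weak_derivative_test[OF hk(1) Suc.prems(2)] by (simp add: k_def)
  qed
  from this[of r] have orth: "(LINT t|lebesgue_on {0..T}. h t * \<phi> t) = 0" if "test_function T \<phi>" for \<phi>
    using that by simp
  have "continuous_on {0..T} h"
    unfolding h_def by (intro continuous_intros) (use f y in \<open>auto simp: sobolev0_def\<close>)
  then have "h t = 0"
    by (rule continuous_zero_if_orthogonal[OF _ \<open>0 < T\<close> orth t])
  then show ?thesis by (simp add: h_def)
qed

section \<open>Linear Volterra integral equations\<close>

text \<open>The inductive step of factorial bounds for iterated integrals.\<close>

lemma indefinite_integral_power_bound:
  fixes v :: "real \<Rightarrow> real"
  assumes v: "integrable (lebesgue_on {0..t}) v" and t: "0 \<le> t"
    and bound: "\<And>s. s \<in> {0..t} \<Longrightarrow> \<bar>v s\<bar> \<le> K * (s ^ k / fact k)"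
  shows "\<bar>LINT s|lebesgue_on {0..t}. v s\<bar> \<le> K * (t ^ Suc k / fact (Suc k))"
proof -
  have cont: "continuous_on {0..t} (\<lambda>s. K * (s ^ k / fact k))"
    by (intro continuous_intros) simp
  have "\<bar>LINT s|lebesgue_on {0..t}. v s\<bar> \<le> (LINT s|lebesgue_on {0..t}. \<bar>v s\<bar>)"
    using integral_norm_bound[of "lebesgue_on {0..t}" v] by simp
  also have "\<dots> \<le> (LINT s|lebesgue_on {0..t}. K * (s ^ k / fact k))"
    by (rule Bochner_Integration.integral_mono[OF _ continuous_imp_integrable_real[OF cont]])
       (use v bound in auto)
  also have "\<dots> = integral {0..t} (\<lambda>s. K * (s ^ k / fact k))"
    by (intro lebesgue_integral_eq_integral continuous_imp_integrable_real cont) simp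
  also have "\<dots> = K * (t ^ Suc k / fact (Suc k)) - K * (0 ^ Suc k / fact (Suc k))"
  proof (intro integral_unique fundamental_theorem_of_calculus t)
    fix s :: real
    have "((\<lambda>s. K * (s ^ Suc k / fact (Suc k))) has_real_derivative K * (real (Suc k) * s ^ k / fact (Suc k))) (at s)"
      using DERIV_cmult[OF DERIV_cdivide[OF DERIV_pow[of "Suc k" s UNIV], of "fact (Suc k)"], of K]
      by (simp only: diff_Suc_Suc diff_zero)
    also have "real (Suc k) * s ^ k / fact (Suc k) = s ^ k / fact k"
      by (simp add: divide_simps)
    finally show "((\<lambda>s. K * (s ^ Suc k / fact (Suc k))) has_vector_derivative K * (s ^ k / fact k)) (at s within {0..t})"
      by (simp add: has_real_derivative_iff_has_vector_derivative[symmetric] has_field_derivative_at_within)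
  qed
  finally show ?thesis by simp
qed

text \<open>The bound on a solution improves with every substitution into the homogeneous equation: after \<open>k\<close> of them it is bounded
  by \<open>L (N t)\<^sup>k / k!\<close>, which tends to \<open>0\<close>.\<close>

lemma linear_volterra_unique:
  fixes a :: "nat \<Rightarrow> nat \<Rightarrow> real" and d :: "nat \<Rightarrow> real \<Rightarrow> real"
  assumes int: "\<And>i. i < n \<Longrightarrow> integrable (lebesgue_on {0..T}) (\<lambda>s. \<Sum>j<n. a i j * d j s)"
    and eq: "\<And>i t. i < n \<Longrightarrow> t \<in> {0..T} \<Longrightarrow> d i t = (LINT s|lebesgue_on {0..t}. (\<Sum>j<n. a i j * d j s))"
    and i: "i < n" and t: "t \<in> {0..T}"
  shows "d i t = 0"
proof -
  define N where "N = (\<Sum>i<n. \<Sum>j<n. \<bar>a i j\<bar>)"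
  have N: "(\<Sum>j<n. \<bar>a i j\<bar>) \<le> N" if "i < n" for i
    unfolding N_def by (rule member_le_sum) (use that in \<open>auto intro: sum_nonneg\<close>)
  have "\<exists>M. \<forall>t\<in>{0..T}. \<bar>d i t\<bar> \<le> M" if "i < n" for i
  proof -
    have "continuous_on {0..T} (\<lambda>t. LINT s|lebesgue_on {0..t}. (\<Sum>j<n. a i j * d j s))"
      by (rule indefinite_integral_continuous_real[OF int[OF that]])
    then have "continuous_on {0..T} (d i)"
      by (rule continuous_on_cong[THEN iffD1, rotated 2]) (simp_all add: eq[OF that])
    then have "bounded (d i ` {0..T})"
      by (intro compact_imp_bounded compact_continuous_image) simp_all
    then show ?thesis
      unfolding bounded_iff by (metis imageI real_norm_def)
  qed
  then obtain M where M: "\<And>i t. i < n \<Longrightarrow> t \<in> {0..T} \<Longrightarrow> \<bar>d i t\<bar> \<le> M i"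
    by metis
  define L where "L = (\<Sum>i<n. \<bar>M i\<bar>)"
  have L: "\<bar>d i t\<bar> \<le> L" if "i < n" "t \<in> {0..T}" for i t
  proof -
    have "\<bar>M i\<bar> \<le> L" unfolding L_def by (rule member_le_sum) (use that in auto)
    with M[OF that] show ?thesis by simp
  qed
  have bound: "\<bar>d i t\<bar> \<le> L * N ^ k * (t ^ k / fact k)" if "i < n" "t \<in> {0..T}" for i t k
    using that
  proof (induction k arbitrary: i t)
    case 0
    then show ?case using L by simp
  next
    case (Suc k)
    have "\<bar>LINT s|lebesgue_on {0..t}. (\<Sum>j<n. a i j * d j s)\<bar> \<le> L * N ^ Suc k * (t ^ Suc k / fact (Suc k))"
    proof (rule indefinite_integral_power_bound)
      show "integrable (lebesgue_on {0..t}) (\<lambda>s. \<Sum>j<n. a i j * d j s)"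
        by (rule integrable_subinterval[OF int]) (use Suc.prems in auto)
      fix s assume s: "s \<in> {0..t}"
      have pos: "0 \<le> L * N ^ k * (s ^ k / fact k)"
        using Suc.IH[of i s] Suc.prems s by fastforce
      have "\<bar>\<Sum>j<n. a i j * d j s\<bar> \<le> (\<Sum>j<n. \<bar>a i j\<bar> * (L * N ^ k * (s ^ k / fact k)))"
      proof (rule order_trans[OF sum_abs], rule sum_mono)
        fix j assume "j \<in> {..<n}"
        then have "\<bar>d j s\<bar> \<le> L * N ^ k * (s ^ k / fact k)"
          using Suc.prems s by (intro Suc.IH) auto
        then show "\<bar>a i j * d j s\<bar> \<le> \<bar>a i j\<bar> * (L * N ^ k * (s ^ k / fact k))"
          unfolding abs_mult by (rule mult_left_mono) simp
      qed
      also have "\<dots> \<le> N * (L * N ^ k * (s ^ k / fact k))"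
        unfolding sum_distrib_right[symmetric] using N[OF Suc.prems(1)] pos by (rule mult_right_mono)
      finally show "\<bar>\<Sum>j<n. a i j * d j s\<bar> \<le> L * N ^ Suc k * (s ^ k / fact k)"
        by (simp add: algebra_simps)
    qed (use Suc.prems in simp)
    then show ?case using eq Suc.prems by simp
  qed
  have "(\<lambda>k. L * (inverse (fact k) * (N * t) ^ k)) \<longlonglongrightarrow> L * 0"
    by (intro tendsto_intros summable_LIMSEQ_zero summable_exp)
  then have "(\<lambda>k. L * N ^ k * (t ^ k / fact k)) \<longlonglongrightarrow> 0"
    by (simp add: power_mult_distrib field_simps)
  then have "\<bar>d i t\<bar> \<le> 0"
    by (rule LIMSEQ_le_const) (use bound[OF i t] in auto)
  then show ?thesis by simp
qed

fun iterated_integral :: "(real \<Rightarrow> real) \<Rightarrow> nat \<Rightarrow> real \<Rightarrow> real" where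
  "iterated_integral u 0 t = (LINT s|lebesgue_on {0..t}. u s)"
| "iterated_integral u (Suc k) t = (LINT s|lebesgue_on {0..t}. iterated_integral u k s)"

lemma iterated_integral_continuous:
  assumes "integrable (lebesgue_on {0..T}) u"
  shows "continuous_on {0..T} (iterated_integral u k)"
proof (induction k)
  case 0
  show ?case using indefinite_integral_continuous_real[OF assms] by simp
next
  case (Suc k)
  show ?case using indefinite_integral_continuous_real[OF continuous_imp_integrable_real[OF Suc]] by simp
qed

lemma iterated_integral_bound:
  assumes u: "integrable (lebesgue_on {0..T}) u"
  shows "\<exists>M\<ge>0. \<forall>k. \<forall>t\<in>{0..T}. \<bar>iterated_integral u k t\<bar> \<le> M * (t ^ k / fact k)"
proof -
  have "bounded (iterated_integral u 0 ` {0..T})"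
    by (intro compact_imp_bounded compact_continuous_image iterated_integral_continuous u) simp
  then obtain M where M: "\<And>t. t \<in> {0..T} \<Longrightarrow> \<bar>iterated_integral u 0 t\<bar> \<le> M"
    unfolding bounded_iff by (metis imageI real_norm_def)
  have "\<bar>iterated_integral u k t\<bar> \<le> \<bar>M\<bar> * (t ^ k / fact k)" if "t \<in> {0..T}" for k t
    using that
  proof (induction k arbitrary: t)
    case 0
    then show ?case using M[of t] by simp
  next
    case (Suc k)
    show ?case
      unfolding iterated_integral.simps
    proof (rule indefinite_integral_power_bound)
      show "integrable (lebesgue_on {0..t}) (iterated_integral u k)"
        using Suc.prems
        by (intro continuous_imp_integrable_real continuous_on_subset[OF iterated_integral_continuous[OF u]]) auto
    qed (use Suc in auto)
  qed
  then show ?thesis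
    by (intro exI[of _ "\<bar>M\<bar>"]) simp
qed

text \<open>With \<open>A\<close> the matrix of the entries \<open>a i j\<close>, the solution is the Picard series \<open>x = \<Sum>k. A\<^sup>k \<beta> w\<^sub>k\<close>, where
  \<open>w\<^sub>k\<close> is the \<open>k + 1\<close> fold indefinite integral of \<open>u\<close>. It is dominated by an exponential
  series, so that it may be integrated term by term; integration and multiplication by \<open>A\<close> shift the series by one.\<close>

lemma linear_volterra_exists:
  fixes a :: "nat \<Rightarrow> nat \<Rightarrow> real" and \<beta> :: "nat \<Rightarrow> real"
  assumes u: "integrable (lebesgue_on {0..T}) u"
  obtains x :: "nat \<Rightarrow> real \<Rightarrow> real" where
    "\<And>i. i < n \<Longrightarrow> integrable (lebesgue_on {0..T}) (\<lambda>s. (\<Sum>j<n. a i j * x j s) + u s * \<beta> i)"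
    "\<And>i t. i < n \<Longrightarrow> t \<in> {0..T} \<Longrightarrow>
       x i t = (LINT s|lebesgue_on {0..t}. (\<Sum>j<n. a i j * x j s) + u s * \<beta> i)"
proof -
  \<comment> \<open>The coefficient vectors \<open>A\<^sup>k \<beta>\<close>.\<close>
  define c where "c = rec_nat \<beta> (\<lambda>_ v i. \<Sum>j<n. a i j * v j)"
  have c_0: "c 0 = \<beta>" and c_Suc: "c (Suc k) i = (\<Sum>j<n. a i j * c k j)" for k i
    by (simp_all add: c_def)
  define N where "N = (\<Sum>i<n. \<Sum>j<n. \<bar>a i j\<bar>)"
  define B where "B = (\<Sum>i<n. \<bar>\<beta> i\<bar>)"
  have N: "(\<Sum>j<n. \<bar>a i j\<bar>) \<le> N" if "i < n" for i
    unfolding N_def by (rule member_le_sum) (use that in \<open>auto intro: sum_nonneg\<close>)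
  have N_nonneg: "0 \<le> N" and B_nonneg: "0 \<le> B"
    by (auto simp: N_def B_def intro!: sum_nonneg)
  have c_bound: "\<bar>c k i\<bar> \<le> B * N ^ k" if "i < n" for k i
    using that
  proof (induction k arbitrary: i)
    case 0
    then show ?case unfolding c_0 B_def by (simp, intro member_le_sum) auto
  next
    case (Suc k)
    have "\<bar>c (Suc k) i\<bar> \<le> (\<Sum>j<n. \<bar>a i j\<bar> * (B * N ^ k))"
      unfolding c_Suc by (rule order_trans[OF sum_abs])
        (use Suc in \<open>auto simp: abs_mult intro!: sum_mono mult_left_mono\<close>)
    also have "\<dots> \<le> N * (B * N ^ k)"
      unfolding sum_distrib_right[symmetric]
      using N[OF Suc.prems] N_nonneg B_nonneg by (intro mult_right_mono) simp_all
    finally show ?case by (simp add: algebra_simps)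
  qed
  define w where "w = iterated_integral u"
  obtain M where M: "0 \<le> M" "\<And>k t. t \<in> {0..T} \<Longrightarrow> \<bar>w k t\<bar> \<le> M * (t ^ k / fact k)"
    using iterated_integral_bound[OF u] unfolding w_def by blast
  have w_cont: "continuous_on {0..t} (w k)" if "t \<in> {0..T}" for k t
    unfolding w_def using that
    by (intro continuous_on_subset[OF iterated_integral_continuous[OF u]]) auto
  define K where "K k = B * M * ((N * T) ^ k / fact k)" for k
  have K_summable: "summable (\<lambda>k. C * K k)" for C
    unfolding K_def by (intro summable_mult) (use summable_exp[of "N * T"] in \<open>simp add: divide_inverse mult.commute\<close>)
  have term_bound: "\<bar>c k i * w k t\<bar> \<le> K k" if "i < n" "t \<in> {0..T}" for k i t
  proof -
    have "\<bar>c k i * w k t\<bar> \<le> (B * N ^ k) * (M * (T ^ k / fact k))"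
      unfolding abs_mult
    proof (rule mult_mono[OF c_bound[OF that(1)]])
      have "t ^ k \<le> T ^ k" using that by (intro power_mono) auto
      then show "\<bar>w k t\<bar> \<le> M * (T ^ k / fact k)"
        by (intro order_trans[OF M(2)[OF that(2)]] mult_left_mono divide_right_mono M(1)) simp_all
    qed (use B_nonneg N_nonneg in simp_all)
    then show ?thesis by (simp add: K_def power_mult_distrib algebra_simps)
  qed
  have term_summable: "summable (\<lambda>k. c k i * w k t)" if "i < n" "t \<in> {0..T}" for i t
    by (rule summable_comparison_test'[of "\<lambda>k. 1 * K k" 0]) (use K_summable[of 1] term_bound[OF that] in auto)
  define x where "x i t = (\<Sum>k. c k i * w k t)" for i t
  have shifted: "(\<Sum>j<n. a i j * x j t) = (\<Sum>k. c (Suc k) i * w k t)"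
    and shifted_bound: "\<bar>c (Suc k) i * w k t\<bar> \<le> N * K k"
    if "i < n" "t \<in> {0..T}" for i t k
  proof -
    have eq: "c (Suc k) i * w k t = (\<Sum>j<n. a i j * (c k j * w k t))" for k
      by (simp add: c_Suc sum_distrib_right mult.assoc)
    have "(\<Sum>j<n. a i j * x j t) = (\<Sum>j<n. \<Sum>k. a i j * (c k j * w k t))"
      unfolding x_def by (intro sum.cong refl suminf_mult[symmetric] term_summable) (use that in auto)
    also have "\<dots> = (\<Sum>k. \<Sum>j<n. a i j * (c k j * w k t))"
      by (intro suminf_sum[symmetric] summable_mult term_summable) (use that in auto)
    finally show "(\<Sum>j<n. a i j * x j t) = (\<Sum>k. c (Suc k) i * w k t)"
      by (simp only: eq)
    have "\<bar>c (Suc k) i * w k t\<bar> \<le> (\<Sum>j<n. \<bar>a i j\<bar> * K k)"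
      unfolding eq by (rule order_trans[OF sum_abs])
        (use term_bound that in \<open>auto simp: abs_mult[of "a _ _"] intro!: sum_mono mult_left_mono\<close>)
    also have "\<dots> \<le> N * K k"
      unfolding sum_distrib_right[symmetric]
      using N[OF that(1)] order_trans[OF abs_ge_zero term_bound[OF that]] by (rule mult_right_mono)
    finally show "\<bar>c (Suc k) i * w k t\<bar> \<le> N * K k" .
  qed
  have main: "integrable (lebesgue_on {0..t}) (\<lambda>s. \<Sum>j<n. a i j * x j s)"
    "(LINT s|lebesgue_on {0..t}. (\<Sum>j<n. a i j * x j s)) = (\<Sum>k. c (Suc k) i * w (Suc k) t)"
    if i: "i < n" and t: "t \<in> {0..T}" for i t
  proof -
    define f where "f k s = c (Suc k) i * w k s" for k s
    have f_bound: "\<bar>f k s\<bar> \<le> N * K k" if "s \<in> {0..t}" for k s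
      unfolding f_def using shifted_bound[OF i, of s k] that t by auto
    have f_cont: "continuous_on {0..t} (f k)" for k
      unfolding f_def by (intro continuous_intros w_cont t)
    have f_int: "integrable (lebesgue_on {0..t}) (f k)" for k
      by (intro continuous_imp_integrable_real f_cont)
    have f_AE: "AE s in lebesgue_on {0..t}. summable (\<lambda>k. norm (f k s))"
      by (rule AE_I2, rule summable_comparison_test'[of "\<lambda>k. N * K k" 0])
         (use K_summable[of N] f_bound in auto)
    have f_norm: "summable (\<lambda>k. LINT s|lebesgue_on {0..t}. norm (f k s))"
    proof (rule summable_comparison_test'[of "\<lambda>k. t * (N * K k)" 0])
      show "summable (\<lambda>k. t * (N * K k))"
        by (intro summable_mult K_summable)
      fix k
      have "(LINT s|lebesgue_on {0..t}. norm (f k s)) \<le> (LINT s|lebesgue_on {0..t}. N * K k)"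
        by (intro Bochner_Integration.integral_mono integrable_norm f_int continuous_imp_integrable_real continuous_intros)
           (use f_bound in auto)
      also have "\<dots> = integral {0..t} (\<lambda>s. N * K k)"
        by (intro lebesgue_integral_eq_integral continuous_imp_integrable_real continuous_intros) simp
      also have "\<dots> = t * (N * K k)" using t by simp
      finally show "norm (LINT s|lebesgue_on {0..t}. norm (f k s)) \<le> t * (N * K k)"
        by simp
    qed
    have f_sum: "(\<Sum>j<n. a i j * x j s) = (\<Sum>k. f k s)" if "s \<in> {0..t}" for s
      unfolding f_def using that t by (intro shifted i) auto
    have "integrable (lebesgue_on {0..t}) (\<lambda>s. \<Sum>k. f k s)"
      by (rule integrable_suminf[OF f_int f_AE f_norm])
    then show "integrable (lebesgue_on {0..t}) (\<lambda>s. \<Sum>j<n. a i j * x j s)"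
      by (rule Bochner_Integration.integrable_cong[THEN iffD1, rotated 2]) (simp_all add: f_sum)
    have "(LINT s|lebesgue_on {0..t}. (\<Sum>j<n. a i j * x j s)) = (LINT s|lebesgue_on {0..t}. (\<Sum>k. f k s))"
      by (rule Bochner_Integration.integral_cong) (simp_all add: f_sum)
    also have "\<dots> = (\<Sum>k. LINT s|lebesgue_on {0..t}. f k s)"
      by (rule integral_suminf[OF f_int f_AE f_norm])
    also have "\<dots> = (\<Sum>k. c (Suc k) i * w (Suc k) t)"
      by (simp add: f_def w_def)
    finally show "(LINT s|lebesgue_on {0..t}. (\<Sum>j<n. a i j * x j s)) = (\<Sum>k. c (Suc k) i * w (Suc k) t)" .
  qed
  have u_int: "integrable (lebesgue_on {0..t}) (\<lambda>s. u s * \<beta> i)" if "t \<in> {0..T}" for t i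
    using integrable_subinterval[OF u, of 0 t] that by auto
  show thesis
  proof (rule that[of x])
    fix i assume i: "i < n"
    show "integrable (lebesgue_on {0..T}) (\<lambda>s. (\<Sum>j<n. a i j * x j s) + u s * \<beta> i)"
    proof (cases "T \<ge> 0")
      case True
      then show ?thesis by (intro Bochner_Integration.integrable_add main(1) u_int i) auto
    qed simp
    fix t assume t: "t \<in> {0..T}"
    have "(LINT s|lebesgue_on {0..t}. (\<Sum>j<n. a i j * x j s) + u s * \<beta> i) =
        (\<Sum>k. c (Suc k) i * w (Suc k) t) + c 0 i * w 0 t"
      using main[OF i t] u_int[OF t, of i] by (simp add: c_0 w_def)
    also have "\<dots> = x i t"
      unfolding x_def using suminf_split_head[OF term_summable[OF i t]] by simp
    finally show "x i t = (LINT s|lebesgue_on {0..t}. (\<Sum>j<n. a i j * x j s) + u s * \<beta> i)" ..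
  qed
qed

section \<open>States and outputs of control systems\<close>

lemma output_value_sum:
  assumes "D \<in> carrier_mat 1 n" "v \<in> carrier_vec n"
  shows "output_value D v = (\<Sum>j<n. D $$ (0, j) * v $ j)"
  using assms by (simp add: output_value_def scalar_prod_def atLeast0LessThan)

lemma output_value_mult:
  assumes "D \<in> carrier_mat 1 n" "A \<in> carrier_mat n m" "v \<in> carrier_vec m"
  shows "output_value (D * A) v = output_value D (A *\<^sub>v v)"
  using assms by (simp add: output_value_def)

lemma output_value_zero: "D \<in> carrier_mat 1 n \<Longrightarrow> output_value D (0\<^sub>v n) = 0"
  by (simp add: output_value_sum)

text \<open>Integrating the equation of state against a fixed row. Changes of coordinates, continuity and the
  differentiation of outputs are all instances of this identity.\<close>

lemma state_output:
  assumes A: "A \<in> carrier_mat n n" and b: "b \<in> carrier_vec n" and D: "D \<in> carrier_mat 1 n"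
    and x: "state n A b T u x"
  shows "integrable (lebesgue_on {0..T}) (\<lambda>s. output_value (D * A) (x s) + output_value D b * u s)"
    and "t \<in> {0..T} \<Longrightarrow> output_value D (x t) =
      (LINT s|lebesgue_on {0..t}. output_value (D * A) (x s) + output_value D b * u s)"
proof -
  have carrier: "x s \<in> carrier_vec n" if "s \<in> {0..T}" for s
    using x that by (simp add: state_def)
  define F where "F i s = (A *\<^sub>v x s + u s \<cdot>\<^sub>v b) $ i" for i s
  have F_int: "integrable (lebesgue_on {0..T}) (F i)" if "i < n" for i
    using x that by (simp add: state_def F_def[abs_def])
  have F_eq: "x t $ i = (LINT s|lebesgue_on {0..t}. F i s)" if "i < n" "t \<in> {0..T}" for i t
    using x that by (simp add: state_def F_def[abs_def])
  have rhs: "output_value (D * A) (x s) + output_value D b * u s = (\<Sum>i<n. D $$ (0, i) * F i s)"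
    if "s \<in> {0..T}" for s
  proof -
    have "(\<Sum>i<n. D $$ (0, i) * F i s) = (\<Sum>i<n. D $$ (0, i) * (A *\<^sub>v x s) $ i + (D $$ (0, i) * b $ i) * u s)"
      using A b by (intro sum.cong) (auto simp: F_def algebra_simps)
    also have "\<dots> = output_value D (A *\<^sub>v x s) + output_value D b * u s"
      using A b D carrier[OF that]
      by (simp add: output_value_sum[of D n] sum.distrib sum_distrib_right)
    finally show ?thesis
      using output_value_mult[OF D A carrier[OF that]] by simp
  qed
  have "integrable (lebesgue_on {0..T}) (\<lambda>s. \<Sum>i<n. D $$ (0, i) * F i s)"
    by (intro Bochner_Integration.integrable_sum integrable_mult_right) (use F_int in auto)
  then show "integrable (lebesgue_on {0..T}) (\<lambda>s. output_value (D * A) (x s) + output_value D b * u s)"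
    by (rule Bochner_Integration.integrable_cong[THEN iffD1, rotated 2]) (simp_all add: rhs)
  assume t: "t \<in> {0..T}"
  have F_int_t: "integrable (lebesgue_on {0..t}) (F i)" if "i < n" for i
    using integrable_subinterval[OF F_int[OF that], of 0 t] t by auto
  have "(LINT s|lebesgue_on {0..t}. output_value (D * A) (x s) + output_value D b * u s) =
      (LINT s|lebesgue_on {0..t}. (\<Sum>i<n. D $$ (0, i) * F i s))"
    by (rule Bochner_Integration.integral_cong) (use t in \<open>simp_all add: rhs\<close>)
  also have "\<dots> = (\<Sum>i<n. D $$ (0, i) * (LINT s|lebesgue_on {0..t}. F i s))"
    using F_int_t by (subst Bochner_Integration.integral_sum) auto
  also have "\<dots> = output_value D (x t)"
    using F_eq t by (simp add: output_value_sum[OF D carrier[OF t]])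
  finally show "output_value D (x t) =
      (LINT s|lebesgue_on {0..t}. output_value (D * A) (x s) + output_value D b * u s)" ..
qed

lemma state_output_continuous:
  assumes A: "A \<in> carrier_mat n n" and b: "b \<in> carrier_vec n" and D: "D \<in> carrier_mat 1 n"
    and x: "state n A b T u x"
  shows "continuous_on {0..T} (\<lambda>t. output_value D (x t))"
  by (rule continuous_on_cong[THEN iffD1, OF refl _ indefinite_integral_continuous_real[OF state_output(1)[OF assms]]])
     (rule state_output(2)[OF assms, symmetric])

text \<open>The matrix \<open>S\<close> may be any intertwiner, so that the lemma covers both directions of a change of
  coordinates.\<close>

lemma state_transform:
  assumes A: "A \<in> carrier_mat n n" and b: "b \<in> carrier_vec n" and S: "S \<in> carrier_mat n n"
    and A': "A' \<in> carrier_mat n n" and intertwine: "A' * S = S * A"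
    and x: "state n A b T u x"
  shows "state n A' (S *\<^sub>v b) T u (\<lambda>t. S *\<^sub>v x t)"
proof -
  have carrier: "x s \<in> carrier_vec n" if "s \<in> {0..T}" for s
    using x that by (simp add: state_def)
  have x0: "x 0 = 0\<^sub>v n" using x by (simp add: state_def)
  have Sx0: "S *\<^sub>v x 0 = 0\<^sub>v n" using S by (auto simp: x0)
  have entry: "integrable (lebesgue_on {0..T}) (\<lambda>s. (A' *\<^sub>v (S *\<^sub>v x s) + u s \<cdot>\<^sub>v (S *\<^sub>v b)) $ i) \<and>
      (\<forall>t\<in>{0..T}. (S *\<^sub>v x t) $ i = (LINT s|lebesgue_on {0..t}. (A' *\<^sub>v (S *\<^sub>v x s) + u s \<cdot>\<^sub>v (S *\<^sub>v b)) $ i))"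
    if i: "i < n" for i
  proof -
    define D where "D = mat 1 n (\<lambda>(_, j). S $$ (i, j))"
    have D: "D \<in> carrier_mat 1 n" by (simp add: D_def)
    have D_value: "output_value D v = (S *\<^sub>v v) $ i" if "v \<in> carrier_vec n" for v
      using S i that unfolding output_value_sum[OF D that]
      by (simp add: D_def scalar_prod_def atLeast0LessThan)
    have eq: "output_value (D * A) (x s) + output_value D b * u s =
        (A' *\<^sub>v (S *\<^sub>v x s) + u s \<cdot>\<^sub>v (S *\<^sub>v b)) $ i" if s: "s \<in> {0..T}" for s
    proof -
      have "A' *\<^sub>v (S *\<^sub>v x s) = S *\<^sub>v (A *\<^sub>v x s)"
        using assoc_mult_mat_vec[OF A' S carrier[OF s]] assoc_mult_mat_vec[OF S A carrier[OF s]]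
        by (simp add: intertwine)
      then show ?thesis
        using output_value_mult[OF D A carrier[OF s]] carrier[OF s] A b S i
        by (simp add: D_value)
    qed
    note out = state_output[OF A b D x]
    have "integrable (lebesgue_on {0..T}) (\<lambda>s. (A' *\<^sub>v (S *\<^sub>v x s) + u s \<cdot>\<^sub>v (S *\<^sub>v b)) $ i)"
      by (rule Bochner_Integration.integrable_cong[THEN iffD1, OF refl _ out(1)]) (simp add: eq)
    moreover have "(S *\<^sub>v x t) $ i = (LINT s|lebesgue_on {0..t}. (A' *\<^sub>v (S *\<^sub>v x s) + u s \<cdot>\<^sub>v (S *\<^sub>v b)) $ i)"
      if t: "t \<in> {0..T}" for t
    proof -
      have "(S *\<^sub>v x t) $ i = output_value D (x t)"
        using D_value[OF carrier[OF t]] by simp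
      also have "\<dots> = (LINT s|lebesgue_on {0..t}. output_value (D * A) (x s) + output_value D b * u s)"
        by (rule out(2)[OF t])
      also have "\<dots> = (LINT s|lebesgue_on {0..t}. (A' *\<^sub>v (S *\<^sub>v x s) + u s \<cdot>\<^sub>v (S *\<^sub>v b)) $ i)"
        by (rule Bochner_Integration.integral_cong[OF refl]) (rule eq, use t in simp)
      finally show ?thesis .
    qed
    ultimately show ?thesis by blast
  qed
  show ?thesis
    unfolding state_def Sx0 using entry S carrier by (simp del: index_mult_mat_vec index_add_vec)
qed

lemma state_unique:
  assumes A: "A \<in> carrier_mat n n" and b: "b \<in> carrier_vec n"
    and x: "state n A b T u x" and y: "state n A b T u y" and t: "t \<in> {0..T}"
  shows "x t = y t"
proof -
  have carrier: "x s \<in> carrier_vec n" "y s \<in> carrier_vec n" if "s \<in> {0..T}" for s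
    using x y that by (simp_all add: state_def)
  define G where "G z i s = (A *\<^sub>v z s + u s \<cdot>\<^sub>v b) $ i" for z i s
  have G_int: "integrable (lebesgue_on {0..T}) (G z i)"
    and G_eq: "t \<in> {0..T} \<Longrightarrow> z t $ i = (LINT s|lebesgue_on {0..t}. G z i s)"
    if "state n A b T u z" "i < n" for z i t
    using that by (simp_all add: state_def G_def[abs_def])
  define d where "d i t = x t $ i - y t $ i" for i t
  have diff: "G x i s - G y i s = (\<Sum>j<n. A $$ (i, j) * d j s)" if "i < n" "s \<in> {0..T}" for i s
    using A b carrier[OF that(2)] that(1)
    by (simp add: G_def d_def scalar_prod_def atLeast0LessThan sum_subtractf right_diff_distrib)
  have "d i t = 0" if i: "i < n" for i
  proof (rule linear_volterra_unique[of n T "\<lambda>i j. A $$ (i, j)" d, OF _ _ i t])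
    fix i assume i: "i < n"
    have "integrable (lebesgue_on {0..T}) (\<lambda>s. G x i s - G y i s)"
      by (intro Bochner_Integration.integrable_diff G_int x y i)
    then show "integrable (lebesgue_on {0..T}) (\<lambda>s. \<Sum>j<n. A $$ (i, j) * d j s)"
      by (rule Bochner_Integration.integrable_cong[THEN iffD1, rotated 2]) (simp_all add: diff i)
    fix t assume t: "t \<in> {0..T}"
    have "d i t = (LINT s|lebesgue_on {0..t}. G x i s) - (LINT s|lebesgue_on {0..t}. G y i s)"
      unfolding d_def using G_eq[OF x i t] G_eq[OF y i t] by simp
    also have "\<dots> = (LINT s|lebesgue_on {0..t}. G x i s - G y i s)"
      by (rule Bochner_Integration.integral_diff[symmetric])
         (rule integrable_subinterval[OF G_int[OF _ i]], rule x y, use t in simp)+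
    also have "\<dots> = (LINT s|lebesgue_on {0..t}. (\<Sum>j<n. A $$ (i, j) * d j s))"
      by (rule Bochner_Integration.integral_cong[OF refl]) (rule diff[OF i], use t in simp)
    finally show "d i t = (LINT s|lebesgue_on {0..t}. (\<Sum>j<n. A $$ (i, j) * d j s))" .
  qed
  then show ?thesis
    using carrier[OF t] by (intro eq_vecI) (auto simp: d_def)
qed

text \<open>Under the feedback \<open>u = v - F z\<close> the system is again linear, with matrix \<open>A - b F\<close> and input \<open>v\<close>.\<close>

lemma closed_loop_state_exists:
  assumes A: "A \<in> carrier_mat n n" and b: "b \<in> carrier_vec n" and F: "F \<in> carrier_mat 1 n"
    and v: "integrable (lebesgue_on {0..T}) v" and "0 \<le> T"
  obtains z where "state n A b T (\<lambda>t. v t - output_value F (z t)) z"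
proof -
  define a where "a i j = A $$ (i, j) - b $ i * F $$ (0, j)" for i j
  obtain x where int: "\<And>i. i < n \<Longrightarrow> integrable (lebesgue_on {0..T}) (\<lambda>s. (\<Sum>j<n. a i j * x j s) + v s * b $ i)"
    and eq: "\<And>i t. i < n \<Longrightarrow> t \<in> {0..T} \<Longrightarrow>
       x i t = (LINT s|lebesgue_on {0..t}. (\<Sum>j<n. a i j * x j s) + v s * b $ i)"
  proof (rule linear_volterra_exists[OF v, of n a "\<lambda>i. b $ i"])
    fix x assume "\<And>i. i < n \<Longrightarrow> integrable (lebesgue_on {0..T}) (\<lambda>s. (\<Sum>j<n. a i j * x j s) + v s * b $ i)"
      "\<And>i t. i < n \<Longrightarrow> t \<in> {0..T} \<Longrightarrow> x i t = (LINT s|lebesgue_on {0..t}. (\<Sum>j<n. a i j * x j s) + v s * b $ i)"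
    then show thesis by (rule that)
  qed
  define z where "z t = vec n (\<lambda>i. x i t)" for t
  have rhs: "(A *\<^sub>v z s + (v s - output_value F (z s)) \<cdot>\<^sub>v b) $ i = (\<Sum>j<n. a i j * x j s) + v s * b $ i"
    if i: "i < n" for i s
  proof -
    have "output_value F (z s) = (\<Sum>j<n. F $$ (0, j) * x j s)"
      using output_value_sum[OF F, of "z s"] by (simp add: z_def)
    moreover have "(A *\<^sub>v z s) $ i = (\<Sum>j<n. A $$ (i, j) * x j s)"
      using A i by (simp add: z_def scalar_prod_def atLeast0LessThan)
    moreover have "(\<Sum>j<n. a i j * x j s) = (\<Sum>j<n. A $$ (i, j) * x j s) - b $ i * (\<Sum>j<n. F $$ (0, j) * x j s)"
      by (simp add: a_def left_diff_distrib sum_subtractf sum_distrib_left mult.assoc)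
    ultimately show ?thesis
      using A b i by (simp add: algebra_simps del: index_mult_mat_vec)
  qed
  have x0: "x i 0 = 0" if "i < n" for i
  proof -
    have "integrable (lebesgue_on {0..0}) (\<lambda>s. (\<Sum>j<n. a i j * x j s) + v s * b $ i)"
      by (rule integrable_subinterval[OF int[OF that]]) (use \<open>0 \<le> T\<close> in auto)
    then show ?thesis
      using eq[OF that, of 0] \<open>0 \<le> T\<close> lebesgue_integral_eq_integral[of "{0..0::real}" "\<lambda>s. (\<Sum>j<n. a i j * x j s) + v s * b $ i"]
      by simp
  qed
  have z0: "z 0 = 0\<^sub>v n"
    by (intro eq_vecI) (simp_all add: z_def x0)
  have "state n A b T (\<lambda>t. v t - output_value F (z t)) z"
    unfolding state_def z0
    using int eq by (simp add: rhs del: index_add_vec index_mult_mat_vec) (simp add: z_def)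
  then show thesis by (rule that)
qed

section \<open>Controller coordinates\<close>

lemma nonsingular_imp_inverse:
  fixes M :: "real mat"
  assumes M: "M \<in> carrier_mat n n" and det: "det M \<noteq> 0"
  obtains N where "N \<in> carrier_mat n n" "M * N = 1\<^sub>m n" "N * M = 1\<^sub>m n"
  using det_non_zero_imp_unit[OF M det, of "()"] that
  by (auto simp: Units_def ring_mat_def)

text \<open>The row is the last one of the inverse of the controllability matrix.\<close>

lemma controllable_imp_dual_row:
  assumes A: "A \<in> carrier_mat n n" and b: "b \<in> carrier_vec n" and "0 < n"
    and "controllable n A b"
  obtains Q where "Q \<in> carrier_mat 1 n"
    "\<And>k. k < n \<Longrightarrow> output_value (Q * A ^\<^sub>m k) b = (if k = n - 1 then 1 else 0)"
proof -
  define K where "K = mat_of_cols n (map (\<lambda>k. (A ^\<^sub>m k) *\<^sub>v b) [0..<n])"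
  have K: "K \<in> carrier_mat n n" by (simp add: K_def mat_of_cols_def)
  have A_pow: "A ^\<^sub>m k \<in> carrier_mat n n" for k using A by simp
  have K_col: "col K k = A ^\<^sub>m k *\<^sub>v b" if "k < n" for k
    unfolding K_def using that by (subst col_mat_of_cols) (auto intro: mult_mat_vec_carrier[OF A_pow b])
  interpret vec_space "TYPE(real)" n .
  have "det K \<noteq> 0"
    using \<open>controllable n A b\<close> det_rank_iff[OF K] by (simp add: controllable_def K_def)
  then obtain L where L: "L \<in> carrier_mat n n" "L * K = 1\<^sub>m n"
    using nonsingular_imp_inverse[OF K] by metis
  define Q where "Q = mat 1 n (\<lambda>(_, j). L $$ (n - 1, j))"
  have Q: "Q \<in> carrier_mat 1 n" by (simp add: Q_def)
  have "output_value (Q * A ^\<^sub>m k) b = (if k = n - 1 then 1 else 0)" if k: "k < n" for k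
  proof -
    have "output_value (Q * A ^\<^sub>m k) b = output_value Q (A ^\<^sub>m k *\<^sub>v b)"
      by (rule output_value_mult[OF Q A_pow b])
    also have "\<dots> = (\<Sum>j<n. L $$ (n - 1, j) * (A ^\<^sub>m k *\<^sub>v b) $ j)"
      by (subst output_value_sum[OF Q mult_mat_vec_carrier[OF A_pow b]]) (simp add: Q_def)
    also have "\<dots> = row L (n - 1) \<bullet> (A ^\<^sub>m k *\<^sub>v b)"
      using L(1) \<open>0 < n\<close> carrier_vecD[OF mult_mat_vec_carrier[OF A_pow[of k] b]]
      by (simp add: scalar_prod_def atLeast0LessThan del: index_mult_mat_vec dim_mult_mat_vec)
    also have "\<dots> = (L * K) $$ (n - 1, k)"
      using L(1) K k \<open>0 < n\<close> by (simp add: K_col del: index_mult_mat_vec)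
    also have "\<dots> = (if k = n - 1 then 1 else 0)"
      using L k \<open>0 < n\<close> by auto
    finally show ?thesis .
  qed
  with Q show thesis by (rule that)
qed

text \<open>The inverse transformation \<open>R\<close> has the rows \<open>Q A\<^sup>i\<close>, so multiplying it by \<open>A\<close> from the right moves each row
  to the next one, which is the companion structure. It is invertible because its product with the
  controllability matrix, columns reversed, is lower triangular with unit diagonal.\<close>

lemma controller_coordinates_exist:
  assumes A: "A \<in> carrier_mat n n" and b: "b \<in> carrier_vec n" and "0 < n"
    and ctrl: "controllable n A b"
  shows "\<exists>P Pinv. controller_coordinates n A b P Pinv"
proof -
  obtain Q where Q: "Q \<in> carrier_mat 1 n"
    and Qb: "\<And>k. k < n \<Longrightarrow> output_value (Q * A ^\<^sub>m k) b = (if k = n - 1 then 1 else 0)"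
    using controllable_imp_dual_row[OF A b \<open>0 < n\<close> ctrl] by blast
  have A_pow: "A ^\<^sub>m k \<in> carrier_mat n n" for k using A by simp
  have QA: "Q * A ^\<^sub>m k \<in> carrier_mat 1 n" for k using Q A_pow by simp
  define R where "R = mat n n (\<lambda>(i, j). (Q * A ^\<^sub>m i) $$ (0, j))"
  have R: "R \<in> carrier_mat n n" by (simp add: R_def)
  have R_vec: "(R *\<^sub>v v) $ i = output_value (Q * A ^\<^sub>m i) v" if "v \<in> carrier_vec n" "i < n" for v i
    using that R output_value_sum[OF QA that(1)] by (simp add: R_def scalar_prod_def atLeast0LessThan)
  have pow_add: "A ^\<^sub>m i * A ^\<^sub>m j = A ^\<^sub>m (i + j)" for i j
  proof (induction j)
    case 0
    show ?case using A_pow[of i] A by simp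
  next
    case (Suc j)
    then show ?case using assoc_mult_mat[OF A_pow[of i] A_pow[of j] A] by simp
  qed
  \<comment> \<open>The controllability matrix with its columns in reverse order.\<close>
  define K where "K = mat n n (\<lambda>(i, j). (A ^\<^sub>m (n - 1 - j) *\<^sub>v b) $ i)"
  have K: "K \<in> carrier_mat n n" by (simp add: K_def)
  have RK: "(R * K) $$ (i, j) = output_value (Q * A ^\<^sub>m (i + (n - 1 - j))) b" if "i < n" "j < n" for i j
  proof -
    have c: "A ^\<^sub>m (n - 1 - j) *\<^sub>v b \<in> carrier_vec n" by (rule mult_mat_vec_carrier[OF A_pow b])
    have "col K j = A ^\<^sub>m (n - 1 - j) *\<^sub>v b"
      using that carrier_vecD[OF c] by (intro eq_vecI) (simp_all add: K_def del: index_mult_mat_vec)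
    then have "(R * K) $$ (i, j) = (R *\<^sub>v (A ^\<^sub>m (n - 1 - j) *\<^sub>v b)) $ i"
      using that R K by simp
    also have "\<dots> = output_value (Q * A ^\<^sub>m i) (A ^\<^sub>m (n - 1 - j) *\<^sub>v b)"
      by (rule R_vec[OF c that(1)])
    also have "\<dots> = output_value (Q * A ^\<^sub>m i * A ^\<^sub>m (n - 1 - j)) b"
      by (rule output_value_mult[OF QA A_pow b, symmetric])
    finally show ?thesis
      using assoc_mult_mat[OF Q A_pow A_pow] by (simp add: pow_add)
  qed
  have "det (R * K) = prod_list (diag_mat (R * K))"
  proof (rule det_lower_triangular)
    show "(R * K) $$ (i, j) = 0" if "i < j" "j < n" for i j
      using that by (subst RK) (auto simp: Qb)
  qed (use R K in simp)
  also have "diag_mat (R * K) = map (\<lambda>_. 1) [0..<n]"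
    unfolding diag_mat_def using R by (intro map_cong) (auto simp: RK Qb)
  also have "prod_list (map (\<lambda>_. 1 :: real) xs) = 1" for xs :: "nat list"
    by (induction xs) simp_all
  finally have "det (R * K) = 1" .
  then have "det R \<noteq> 0" using det_mult[OF R K] by auto
  then obtain P where P: "P \<in> carrier_mat n n" "R * P = 1\<^sub>m n" "P * R = 1\<^sub>m n"
    using nonsingular_imp_inverse[OF R] by metis
  define a where "a j = - (R * A * P) $$ (n - 1, j)" for j
  have "R * A * P = companion n a"
  proof (rule eq_matI)
    fix i j assume "i < dim_row (companion n a)" "j < dim_col (companion n a)"
    then have ij: "i < n" "j < n" by (simp_all add: companion_def)
    show "(R * A * P) $$ (i, j) = companion n a $$ (i, j)"
    proof (cases "i = n - 1")
      case True
      then show ?thesis using ij by (simp add: companion_def a_def)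
    next
      case False
      then have i: "Suc i < n" using ij by auto
      have "row (R * A) i = row R (Suc i)"
      proof (rule eq_vecI)
        fix k assume "k < dim_vec (row R (Suc i))"
        then have k: "k < n" using R by simp
        have "(R * A) $$ (i, k) = (R *\<^sub>v col A k) $ i"
          using R A ij k by simp
        also have "\<dots> = output_value (Q * A ^\<^sub>m i) (col A k)"
          by (rule R_vec) (use A k ij in auto)
        also have "\<dots> = (Q * A ^\<^sub>m i * A) $$ (0, k)"
          using Q A k by (simp add: output_value_def)
        also have "\<dots> = (Q * A ^\<^sub>m Suc i) $$ (0, k)"
          using assoc_mult_mat[OF Q A_pow A] by simp
        finally show "row (R * A) i $ k = row R (Suc i) $ k"
          using R A ij i k by (simp add: R_def)
      qed (use R A in simp)
      moreover have "(R * A * P) $$ (i, j) = row (R * A) i \<bullet> col P j"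
        using R P(1) ij by (intro index_mult_mat) auto
      moreover have "(R * P) $$ (Suc i, j) = row R (Suc i) \<bullet> col P j"
        using R P(1) ij i by (intro index_mult_mat) auto
      ultimately have "(R * A * P) $$ (i, j) = (R * P) $$ (Suc i, j)"
        by (simp only:)
      then show ?thesis
        using P ij i False by (auto simp: companion_def)
    qed
  qed (use R P in \<open>simp_all add: companion_def\<close>)
  moreover have "R *\<^sub>v b = unit_vec n (n - 1)"
    by (rule eq_vecI) (use R b in \<open>auto simp: R_vec Qb unit_vec_def simp del: index_mult_mat_vec\<close>)
  ultimately show ?thesis
    unfolding controller_coordinates_def inverts_mat_def
    using P R by (intro exI[of _ P] exI[of _ R]) auto
qed

section \<open>Relative degree of a companion system\<close>

lemma mult_companion_entry:
  assumes D: "D \<in> carrier_mat 1 n" and j: "j < n"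
  shows "(D * companion n a) $$ (0, j) = (if j = 0 then 0 else D $$ (0, j - 1)) - D $$ (0, n - 1) * a j"
proof -
  have "(D * companion n a) $$ (0, j) = (\<Sum>i<n. D $$ (0, i) * companion n a $$ (i, j))"
    using D j by (simp add: companion_def scalar_prod_def atLeast0LessThan)
  also have "\<dots> = (\<Sum>i<n. (if i = n - 1 then - (D $$ (0, n - 1) * a j) else 0) +
      (if i = j - 1 \<and> j \<noteq> 0 then D $$ (0, j - 1) else 0))"
    using j by (intro sum.cong) (auto simp: companion_def)
  also have "\<dots> = (if j = 0 then 0 else D $$ (0, j - 1)) - D $$ (0, n - 1) * a j"
    using j by (cases "j = 0") (simp_all add: sum.distrib)
  finally show ?thesis .
qed

text \<open>As long as the last entry of \<open>D A\<^sup>k\<close> is zero, multiplication by the companion matrix only shifts the row.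
  The last nonzero entry of \<open>D\<close>, at position \<open>n - r\<close>, thus reaches the end after \<open>r - 1\<close> steps.\<close>

lemma companion_relative_degree:
  assumes D: "D \<in> carrier_mat 1 n" and nz: "\<exists>j<n. D $$ (0, j) \<noteq> 0" and r: "r = relative_degree n D"
    and A: "A = companion n a" and b: "b = unit_vec n (n - 1)"
  shows "0 < r" "\<And>k. k < r - 1 \<Longrightarrow> output_value (D * A ^\<^sub>m k) b = 0"
    "output_value (D * A ^\<^sub>m (r - 1)) b \<noteq> 0"
proof -
  define S where "S = {j \<in> {1..n}. D $$ (0, j - 1) \<noteq> 0}"
  define m where "m = Max S"
  have "finite S" by (simp add: S_def)
  obtain j where "j < n" "D $$ (0, j) \<noteq> 0" using nz by blast
  then have "Suc j \<in> S" by (simp add: S_def)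
  then have "m \<in> S" unfolding m_def using \<open>finite S\<close> by (intro Max_in) auto
  then have m: "1 \<le> m" "m \<le> n" "D $$ (0, m - 1) \<noteq> 0" by (auto simp: S_def)
  have above: "D $$ (0, j) = 0" if "m \<le> j" "j < n" for j
  proof (rule ccontr)
    assume "D $$ (0, j) \<noteq> 0"
    then have "Suc j \<in> S" using that by (simp add: S_def)
    then have "Suc j \<le> m" unfolding m_def by (intro Max_ge \<open>finite S\<close>)
    then show False using that by simp
  qed
  have r_eq: "r = n - m + 1"
    by (simp add: r relative_degree_def m_def S_def)
  then show "0 < r" by simp
  have A_carrier: "A \<in> carrier_mat n n" by (simp add: A companion_def)
  have A_pow: "A ^\<^sub>m k \<in> carrier_mat n n" for k using A_carrier by simp
  have shift: "(D * A ^\<^sub>m k) $$ (0, j) = (if k \<le> j then D $$ (0, j - k) else 0)" if "k < r" "j < n" for k j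
    using that
  proof (induction k arbitrary: j)
    case 0
    then show ?case using D A_carrier by simp
  next
    case (Suc k)
    have k: "k < n - m" using Suc.prems r_eq by simp
    have Dk: "D * A ^\<^sub>m k \<in> carrier_mat 1 n" using D A_pow[of k] by simp
    have last: "(D * A ^\<^sub>m k) $$ (0, n - 1) = 0"
      using Suc.IH[of "n - 1"] Suc.prems k above[of "n - 1 - k"] by simp
    have "(D * A ^\<^sub>m Suc k) $$ (0, j) = (D * A ^\<^sub>m k * companion n a) $$ (0, j)"
      using assoc_mult_mat[OF D A_pow[of k] A_carrier] by (simp add: A)
    also have "\<dots> = (if j = 0 then 0 else (D * A ^\<^sub>m k) $$ (0, j - 1))"
      unfolding mult_companion_entry[OF Dk Suc.prems(2)] last by simp
    also have "\<dots> = (if Suc k \<le> j then D $$ (0, j - Suc k) else 0)"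
      using Suc.IH[of "j - 1"] Suc.prems by auto
    finally show ?case .
  qed
  have out: "output_value (D * A ^\<^sub>m k) b = D $$ (0, n - 1 - k)" if "k < r" for k
  proof -
    have Dk: "D * A ^\<^sub>m k \<in> carrier_mat 1 n" using D A_pow[of k] by simp
    have "output_value (D * A ^\<^sub>m k) b = (\<Sum>j<n. (D * A ^\<^sub>m k) $$ (0, j) * b $ j)"
      by (rule output_value_sum[OF Dk]) (simp add: b)
    also have "\<dots> = (\<Sum>j<n. if j = n - 1 then (D * A ^\<^sub>m k) $$ (0, j) else 0)"
      by (intro sum.cong) (auto simp: b)
    also have "\<dots> = (D * A ^\<^sub>m k) $$ (0, n - 1)"
      using m by simp
    also have "\<dots> = D $$ (0, n - 1 - k)"
      using shift[OF that, of "n - 1"] m that r_eq by simp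
    finally show ?thesis .
  qed
  show "output_value (D * A ^\<^sub>m k) b = 0" if "k < r - 1" for k
    using out[of k] above[of "n - 1 - k"] that r_eq m by simp
  show "output_value (D * A ^\<^sub>m (r - 1)) b \<noteq> 0"
    using out[of "r - 1"] r_eq m by simp
qed

section \<open>Output tracking\<close>

text \<open>What the tracking problem needs to know of a system: the input enters the derivatives of the output
  first at order \<open>r\<close>.\<close>

locale scalar_output_system =
  fixes n :: nat and A :: "real mat" and b :: "real vec" and D :: "real mat" and T :: real and r :: nat
  assumes A: "A \<in> carrier_mat n n" and b: "b \<in> carrier_vec n" and D: "D \<in> carrier_mat 1 n"
    and T: "0 < T" and r: "0 < r"
    and markov: "\<And>k. k < r - 1 \<Longrightarrow> output_value (D * A ^\<^sub>m k) b = 0"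
    and gain: "output_value (D * A ^\<^sub>m (r - 1)) b \<noteq> 0"
begin

lemma DA: "D * A ^\<^sub>m k \<in> carrier_mat 1 n"
  using D A by (metis mult_carrier_mat pow_carrier_mat)

lemma DA_Suc: "D * A ^\<^sub>m k * A = D * A ^\<^sub>m Suc k"
  using assoc_mult_mat[OF D pow_carrier_mat[OF A, of k] A] by simp

lemma DA_0: "D * A ^\<^sub>m 0 = D"
  using D A by simp

lemma output_derivatives:
  assumes u: "u \<in> L2 T" and z: "state n A b T u z"
  shows "k < r \<Longrightarrow> weak_derivative T k (\<lambda>t. output_value D (z t)) (\<lambda>t. output_value (D * A ^\<^sub>m k) (z t))"
    and "weak_derivative T r (\<lambda>t. output_value D (z t))
      (\<lambda>t. output_value (D * A ^\<^sub>m r) (z t) + output_value (D * A ^\<^sub>m (r - 1)) b * u t)"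
proof -
  have L2: "(\<lambda>t. output_value (D * A ^\<^sub>m k) (z t)) \<in> L2 T" for k
    by (rule continuous_imp_L2[OF state_output_continuous[OF A b DA z]])
  have step: "weak_derivative T (Suc k) (\<lambda>t. output_value D (z t))
      (\<lambda>t. output_value (D * A ^\<^sub>m Suc k) (z t) + output_value (D * A ^\<^sub>m k) b * u t)"
    if "weak_derivative T k (\<lambda>t. output_value D (z t)) (\<lambda>t. output_value (D * A ^\<^sub>m k) (z t))" for k
    by (rule weak_derivative_Suc[OF that L2_add[OF L2 L2_cmult[OF u]]])
       (use state_output(2)[OF A b DA z, of _ k] in \<open>simp add: DA_Suc\<close>)
  show weak: "weak_derivative T k (\<lambda>t. output_value D (z t)) (\<lambda>t. output_value (D * A ^\<^sub>m k) (z t))"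
    if "k < r" for k
    using that
  proof (induction k)
    case 0
    show ?case using weak_derivative_0[OF L2[of 0]] by (simp add: DA_0 del: pow_mat.simps)
  next
    case (Suc k)
    then show ?case using step[of k] markov[of k] by (simp del: pow_mat.simps)
  qed
  show "weak_derivative T r (\<lambda>t. output_value D (z t))
      (\<lambda>t. output_value (D * A ^\<^sub>m r) (z t) + output_value (D * A ^\<^sub>m (r - 1)) b * u t)"
    using step[OF weak[of "r - 1"]] r by (simp del: pow_mat.simps)
qed

lemma differentiate_output: "differentiate_output n T r A b D"
  unfolding differentiate_output_def
  using gain markov output_derivatives by auto

lemma output_in_sobolev0:
  assumes u: "u \<in> L2 T" and z: "state n A b T u z"
  shows "(\<lambda>t. output_value D (z t)) \<in> sobolev0 r T"
proof -
  have z0: "z 0 = 0\<^sub>v n" using z by (simp add: state_def)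
  have "\<exists>g. weak_derivative T k (\<lambda>t. output_value D (z t)) g" if "k \<le> r" for k
    using output_derivatives(1)[OF u z, of k] output_derivatives(2)[OF u z] that by (cases "k = r") auto
  moreover have "\<exists>g. weak_derivative T k (\<lambda>t. output_value D (z t)) g \<and> continuous_on {0..T} g \<and> g 0 = 0"
    if "k < r" for k
    using output_derivatives(1)[OF u z that] state_output_continuous[OF A b DA z] output_value_zero[OF DA]
    by (intro exI[of _ "\<lambda>t. output_value (D * A ^\<^sub>m k) (z t)"]) (simp add: z0)
  ultimately show ?thesis
    using state_output_continuous[OF A b D z] by (auto simp: sobolev0_def sobolev_def)
qed

text \<open>The control law says that output and target have the same \<open>r\<close>-th weak derivative. For the converse
  direction, both belong to \<open>H\<^sup>r\<^sub>0\<close> and are therefore determined by it.\<close>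

lemma tracking_iff_control_law:
  assumes f: "f \<in> sobolev0 r T" and u: "u \<in> L2 T" and z: "state n A b T u z"
  shows "(\<forall>t\<in>{0..T}. output_value D (z t) = f t) \<longleftrightarrow> control_law T r A b D f u z"
proof
  assume track: "\<forall>t\<in>{0..T}. output_value D (z t) = f t"
  show "control_law T r A b D f u z"
    unfolding control_law_def
  proof (intro allI impI)
    fix g assume g: "weak_derivative T r f g"
    have "AE t in lebesgue_on {0<..<T}.
        g t = output_value (D * A ^\<^sub>m r) (z t) + output_value (D * A ^\<^sub>m (r - 1)) b * u t"
      by (rule weak_derivative_unique[OF g output_derivatives(2)[OF u z]]) (use track in simp)
    then show "AE t in lebesgue_on {0<..<T}.
        u t = (g t - output_value (D * A ^\<^sub>m r) (z t)) / output_value (D * A ^\<^sub>m (r - 1)) b"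
      by eventually_elim (use gain in simp)
  qed
next
  assume law: "control_law T r A b D f u z"
  obtain g where g: "weak_derivative T r f g"
    using f by (auto simp: sobolev0_def sobolev_def)
  have "AE t in lebesgue_on {0<..<T}.
      u t = (g t - output_value (D * A ^\<^sub>m r) (z t)) / output_value (D * A ^\<^sub>m (r - 1)) b"
    using law g by (simp add: control_law_def)
  then have eq: "AE t in lebesgue_on {0<..<T}.
      g t = output_value (D * A ^\<^sub>m r) (z t) + output_value (D * A ^\<^sub>m (r - 1)) b * u t"
    by eventually_elim (use gain in simp)
  show "\<forall>t\<in>{0..T}. output_value D (z t) = f t"
    using sobolev0_determined_by_weak_derivative[OF f output_in_sobolev0[OF u z] r T g output_derivatives(2)[OF u z] eq]
    by simp
qed

text \<open>The control law is a state feedback with the additional input \<open>g / c\<close>, where \<open>g\<close> is the \<open>r\<close>-th weak derivative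
  of the target.\<close>

lemma tracking_control_exists:
  assumes f: "f \<in> sobolev0 r T"
  shows "\<exists>u\<in>L2 T. \<exists>z. state n A b T u z \<and> (\<forall>t\<in>{0..T}. output_value D (z t) = f t)"
proof -
  define c where "c = output_value (D * A ^\<^sub>m (r - 1)) b"
  define F where "F = mat 1 n (\<lambda>ij. (D * A ^\<^sub>m r) $$ ij / c)"
  have F: "F \<in> carrier_mat 1 n" by (simp add: F_def)
  have F_value: "output_value F v = output_value (D * A ^\<^sub>m r) v / c" if "v \<in> carrier_vec n" for v
    unfolding output_value_sum[OF F that] output_value_sum[OF DA that] by (simp add: F_def sum_divide_distrib)
  obtain g where g: "weak_derivative T r f g"
    using f by (auto simp: sobolev0_def sobolev_def)
  have "(\<lambda>t. 1 / c * g t) \<in> L2 T"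
    using g by (intro L2_cmult) (simp add: weak_derivative_def)
  then have v: "(\<lambda>t. g t / c) \<in> L2 T" by simp
  obtain z where z: "state n A b T (\<lambda>t. g t / c - output_value F (z t)) z"
    using closed_loop_state_exists[OF A b F L2_imp_integrable[OF v] less_imp_le[OF T]] by blast
  define u where "u t = g t / c - output_value F (z t)" for t
  have zu: "state n A b T u z" using z by (simp add: u_def[abs_def])
  have u: "u \<in> L2 T"
    unfolding u_def by (intro L2_diff v continuous_imp_L2 state_output_continuous[OF A b F zu])
  have "control_law T r A b D f u z"
    unfolding control_law_def
  proof (intro allI impI)
    fix g' assume "weak_derivative T r f g'"
    then have "AE t in lebesgue_on {0<..<T}. g t = g' t"
      by (rule weak_derivative_unique[OF g]) simp
    moreover have "AE t in lebesgue_on {0<..<T}. z t \<in> carrier_vec n"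
      using zu by (intro AE_I2) (simp add: state_def)
    ultimately show "AE t in lebesgue_on {0<..<T}.
        u t = (g' t - output_value (D * A ^\<^sub>m r) (z t)) / output_value (D * A ^\<^sub>m (r - 1)) b"
      by eventually_elim (simp add: u_def F_value diff_divide_distrib del: One_nat_def flip: c_def)
  qed
  then show ?thesis
    using u zu tracking_iff_control_law[OF f u zu] by blast
qed

end

section \<open>Tracking from controllability\<close>

theorem theorem5p1:
  fixes n :: nat and T :: real and A C :: "real mat" and b :: "real vec"
  assumes "T > 0"
    and "A \<in> carrier_mat n n" and "b \<in> carrier_vec n" and "C \<in> carrier_mat 1 n"
    and "controllable n A b"
    and "C \<noteq> 0\<^sub>m 1 n"
  shows "(\<exists>P Pinv. controller_coordinates n A b P Pinv) \<and>
    (\<forall>P Pinv r At bt Ct.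
      controller_coordinates n A b P Pinv \<and>
      At = Pinv * A * P \<and> bt = Pinv *\<^sub>v b \<and> Ct = C * P \<and> r = relative_degree n Ct \<longrightarrow>
      (\<forall>f\<in>sobolev0 r T. \<exists>u\<in>L2 T.
         (\<exists>x. state n A b T u x) \<and>
         (\<forall>x. state n A b T u x \<longrightarrow> (\<forall>t\<in>{0..T}. output_value C (x t) = f t))) \<and>
      differentiate_output n T r At bt Ct \<and>
      (\<forall>f\<in>sobolev0 r T. \<forall>u\<in>L2 T. \<forall>x. state n A b T u x \<longrightarrow>
         state n At bt T u (\<lambda>t. Pinv *\<^sub>v x t) \<and>
         ((\<forall>t\<in>{0..T}. output_value C (x t) = f t) \<longleftrightarrow>
          control_law T r At bt Ct f u (\<lambda>t. Pinv *\<^sub>v x t))))"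
proof (intro conjI allI impI)
  note T = assms(1) and A = assms(2) and b = assms(3) and C = assms(4)
  have "n \<noteq> 0"
  proof
    assume "n = 0"
    then have "C = 0\<^sub>m 1 n" using C by (intro eq_matI) auto
    with assms(6) show False by simp
  qed
  then show "\<exists>P Pinv. controller_coordinates n A b P Pinv"
    by (intro controller_coordinates_exist[OF A b _ assms(5)]) simp
  fix P Pinv r At bt Ct
  assume coords: "controller_coordinates n A b P Pinv \<and>
      At = Pinv * A * P \<and> bt = Pinv *\<^sub>v b \<and> Ct = C * P \<and> r = relative_degree n Ct"
  then have At: "At = Pinv * A * P" and bt: "bt = Pinv *\<^sub>v b" and Ct: "Ct = C * P"
    and r: "r = relative_degree n Ct" by simp_all
  have P: "P \<in> carrier_mat n n" and Pinv: "Pinv \<in> carrier_mat n n"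
    and inv: "P * Pinv = 1\<^sub>m n" "Pinv * P = 1\<^sub>m n"
    and unit: "bt = unit_vec n (n - 1)"
    using coords by (auto simp: controller_coordinates_def inverts_mat_def)
  obtain a where comp: "At = companion n a"
    using coords by (auto simp: controller_coordinates_def)
  have At_carrier: "At \<in> carrier_mat n n" using A P Pinv by (simp add: At)
  have bt_carrier: "bt \<in> carrier_vec n" by (simp add: unit)
  have Ct_carrier: "Ct \<in> carrier_mat 1 n" using C P by (simp add: Ct)
  have "\<exists>j<n. Ct $$ (0, j) \<noteq> 0"
  proof (rule ccontr)
    assume "\<not> (\<exists>j<n. Ct $$ (0, j) \<noteq> 0)"
    then have "Ct = 0\<^sub>m 1 n" using Ct_carrier by (intro eq_matI) auto
    then have "C * P * Pinv = 0\<^sub>m 1 n" using Pinv by (simp add: Ct[symmetric])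
    then show False using assms(6) assoc_mult_mat[OF C P Pinv] C by (simp add: inv)
  qed
  note rel = companion_relative_degree[OF Ct_carrier this r comp unit]
  interpret sys: scalar_output_system n At bt Ct T r
    by unfold_locales (use At_carrier bt_carrier Ct_carrier T rel in auto)
  have forward: "state n At bt T u (\<lambda>t. Pinv *\<^sub>v x t)" if "state n A b T u x" for u x
  proof -
    have "At * Pinv = Pinv * A * (P * Pinv)"
      unfolding At using A P Pinv by (intro assoc_mult_mat) auto
    also have "\<dots> = Pinv * A"
      using A Pinv by (simp add: inv)
    finally show ?thesis
      unfolding bt by (rule state_transform[OF A b Pinv At_carrier _ that])
  qed
  have backward: "state n A b T u (\<lambda>t. P *\<^sub>v z t)" if "state n At bt T u z" for u z
  proof -
    have "P * At = P * Pinv * (A * P)"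
      unfolding At using A P Pinv by (simp add: assoc_mult_mat[of _ n n _ n _ n])
    then have "A * P = P * At"
      using A P by (simp add: inv)
    moreover have "P *\<^sub>v bt = b"
      using assoc_mult_mat_vec[OF P Pinv b] b by (simp add: bt inv)
    ultimately show ?thesis
      using state_transform[OF At_carrier bt_carrier P A _ that] by simp
  qed
  have same_output: "output_value Ct (Pinv *\<^sub>v x t) = output_value C (x t)"
    if "state n A b T u x" "t \<in> {0..T}" for u x t
  proof -
    have x: "x t \<in> carrier_vec n" using that by (simp add: state_def)
    have "output_value Ct (Pinv *\<^sub>v x t) = output_value C (P *\<^sub>v (Pinv *\<^sub>v x t))"
      unfolding Ct by (rule output_value_mult[OF C P]) (use Pinv x in simp)
    also have "P *\<^sub>v (Pinv *\<^sub>v x t) = x t"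
      using assoc_mult_mat_vec[OF P Pinv x] x by (simp add: inv)
    finally show ?thesis .
  qed
  show "\<forall>f\<in>sobolev0 r T. \<exists>u\<in>L2 T. (\<exists>x. state n A b T u x) \<and>
      (\<forall>x. state n A b T u x \<longrightarrow> (\<forall>t\<in>{0..T}. output_value C (x t) = f t))"
  proof
    fix f assume "f \<in> sobolev0 r T"
    then obtain u z where u: "u \<in> L2 T" and z: "state n At bt T u z"
      and track: "\<And>t. t \<in> {0..T} \<Longrightarrow> output_value Ct (z t) = f t"
      using sys.tracking_control_exists by blast
    have "output_value C (x t) = f t" if x: "state n A b T u x" and t: "t \<in> {0..T}" for x t
      using same_output[OF x t] track[OF t] state_unique[OF At_carrier bt_carrier forward[OF x] z t] by simp
    then show "\<exists>u\<in>L2 T. (\<exists>x. state n A b T u x) \<and>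
        (\<forall>x. state n A b T u x \<longrightarrow> (\<forall>t\<in>{0..T}. output_value C (x t) = f t))"
      using u backward[OF z] by blast
  qed
  show "differentiate_output n T r At bt Ct"
    by (rule sys.differentiate_output)
  show "\<forall>f\<in>sobolev0 r T. \<forall>u\<in>L2 T. \<forall>x. state n A b T u x \<longrightarrow>
      state n At bt T u (\<lambda>t. Pinv *\<^sub>v x t) \<and>
      ((\<forall>t\<in>{0..T}. output_value C (x t) = f t) \<longleftrightarrow>
       control_law T r At bt Ct f u (\<lambda>t. Pinv *\<^sub>v x t))"
  proof (intro ballI allI impI)
    fix f u x assume f: "f \<in> sobolev0 r T" and u: "u \<in> L2 T" and x: "state n A b T u x"
    show "state n At bt T u (\<lambda>t. Pinv *\<^sub>v x t) \<and>
      ((\<forall>t\<in>{0..T}. output_value C (x t) = f t) \<longleftrightarrow>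
       control_law T r At bt Ct f u (\<lambda>t. Pinv *\<^sub>v x t))"
      using forward[OF x] sys.tracking_iff_control_law[OF f u forward[OF x]] same_output[OF x] by simp
  qed
qed

end
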